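(* Let $a>0$, $\Omega=(-a,a)$, $K\in\mathcal{C}^{(n,n)}(\Omega\times\Omega)$, $x_1,\ldots,x_n\in\mathbb{R}$, and $\mathbf{K}_\varepsilon=[K(\varepsilon x_i,\varepsilon x_j)]_{i,j=1}^n$. Assume that for some $\varepsilon_0>0$, $\mathbf{K}_\varepsilon$ is symmetric positive semidefinite for all $\varepsilon\in[0,\varepsilon_0]$, and that $\varepsilon\mapsto\mathbf{K}_\varepsilon$ is analytic in a neighbourhood of $0$. Let $\lambda_1(\varepsilon)\ge\cdots\ge\lambda_n(\varepsilon)$ be its eigenvalues for small $\varepsilon>0$. Then for each $1\le s\le n$, \[\lambda_s(\varepsilon)=\varepsilon^{2(s-1)}\big(\widetilde{\lambda}_s+\mathcal{O}(\varepsilon)\big)\] for some real numbers $\widetilde\lambda_s$, and these satisfy \[\widetilde{\lambda}_1\cdots\widetilde{\lambda}_s=\det(\mathbf{V}_{\le s-1}^{\top}\mathbf{V}_{\le s-1})\,\det(\mathbf{W}_{s-1}),\qquad 1\le s\le n.\]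
   Context: $K\in\mathcal{C}^{(\ell,\ell)}(\Omega\times\Omega)$ means that all partial derivatives $K^{(i,j)}=\frac{\partial^{i+j}K}{\partial x^i\partial y^j}$ exist and are continuous on $\Omega\times\Omega$ for $0\le i,j\le\ell$. Wronskian: $\mathbf{W}_k=\Big[\frac{K^{(i,j)}(0,0)}{i!\,j!}\Big]_{i,j=0}^{k}$. Vandermonde: $\mathbf{V}_{\le k}=[x_i^{j}]_{1\le i\le n,\,0\le j\le k}\in\mathbb{R}^{n\times(k+1)}$. *)

theory Defs
  imports "HOL-Analysis.Analysis" "HOL-Library.Landau_Symbols"
    "Jordan_Normal_Form.Determinant" "Jordan_Normal_Form.Char_Poly"
begin

fun pderiv2 :: "(real \<Rightarrow> real \<Rightarrow> real) \<Rightarrow> nat \<Rightarrow> nat \<Rightarrow> real \<Rightarrow> real \<Rightarrow> real" where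
  "pderiv2 K 0 0 = K"
| "pderiv2 K 0 (Suc j) = (\<lambda>x y. deriv (\<lambda>u. pderiv2 K 0 j x u) y)"
| "pderiv2 K (Suc i) j = (\<lambda>x y. deriv (\<lambda>t. pderiv2 K i j t y) x)"

definition C_ll :: "nat \<Rightarrow> real set \<Rightarrow> (real \<Rightarrow> real \<Rightarrow> real) \<Rightarrow> bool" where
  "C_ll l \<Omega> K \<longleftrightarrow>
     (\<forall>j<l. \<forall>x\<in>\<Omega>. \<forall>y\<in>\<Omega>.
        ((\<lambda>u. pderiv2 K 0 j x u) has_real_derivative pderiv2 K 0 (Suc j) x y) (at y)) \<and>
     (\<forall>i<l. \<forall>j\<le>l. \<forall>x\<in>\<Omega>. \<forall>y\<in>\<Omega>.
        ((\<lambda>t. pderiv2 K i j t y) has_real_derivative pderiv2 K (Suc i) j x y) (at x)) \<and>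
     (\<forall>i\<le>l. \<forall>j\<le>l. continuous_on (\<Omega> \<times> \<Omega>) (\<lambda>(x, y). pderiv2 K i j x y))"

definition real_analytic_on :: "(real \<Rightarrow> real) \<Rightarrow> real set \<Rightarrow> bool" where
  "real_analytic_on f S \<longleftrightarrow>
     (\<forall>a\<in>S. \<exists>c r. r > 0 \<and> (\<forall>e. \<bar>e - a\<bar> < r \<longrightarrow> (\<lambda>k. c k * (e - a) ^ k) sums f e))"

definition sym_psd_mat :: "real mat \<Rightarrow> bool" where
  "sym_psd_mat A \<longleftrightarrow> A \<in> carrier_mat (dim_row A) (dim_row A) \<and> transpose_mat A = A \<and>
     (\<forall>v \<in> carrier_vec (dim_row A). v \<bullet> (A *\<^sub>v v) \<ge> 0)"

definition Kmat :: "(real \<Rightarrow> real \<Rightarrow> real) \<Rightarrow> nat \<Rightarrow> (nat \<Rightarrow> real) \<Rightarrow> real \<Rightarrow> real mat" where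
  "Kmat K n x e = mat n n (\<lambda>(i, j). K (e * x i) (e * x j))"

definition vandermonde :: "nat \<Rightarrow> (nat \<Rightarrow> real) \<Rightarrow> nat \<Rightarrow> real mat" where
  "vandermonde n x k = mat n (k + 1) (\<lambda>(i, j). x i ^ j)"

definition wronskian :: "(real \<Rightarrow> real \<Rightarrow> real) \<Rightarrow> nat \<Rightarrow> real mat" where
  "wronskian K k = mat (k + 1) (k + 1) (\<lambda>(i, j). pderiv2 K i j 0 0 / (fact i * fact j))"

end

theory Submission
  imports Defs "HOL-Real_Asymp.Real_Asymp" "HOL-Complex_Analysis.Cauchy_Integral_Formula"
begin

text \<open>Orthogonalise the Vandermonde columns into an orthogonal matrix \<open>Q\<close> whose column \<open>i\<close> (counted from 0)
  annihilates all polynomials of degree below \<open>i\<close> on the nodes, which need not be distinct. By a mixed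
  Taylor expansion the entries of \<open>B(e) = Q\<^sup>T K(e) Q\<close> are \<open>e^(i+j) (R\<^sub>i W\<^sub>i\<^sub>j R\<^sub>j + o(1))\<close>. Courant-Fischer on
  vectors whose first coordinates vanish gives \<open>lam\<^sub>i = O(e^(2i))\<close>, and the limit of
  \<open>e^(s^2) det (1 + e^(1-2s) B(e))\<close>, computed from the eigenvalues and from the entries, gives the
  product formula.

  The error term needs expansions of the eigenvalues in integer powers of \<open>e\<close>, a form of Rellich's
  theorem. The power sums of the eigenvalues are traces of powers of \<open>K(e)\<close>, so they have expansions at
  0 from both sides. The eigenvalues cluster at finitely many limits \<open>\<mu>\<close> at distance \<open>O(e)\<close>, because a
  nonnegative function with a two-sided expansion that vanishes at 0 is \<open>O(e^2)\<close>. The power sums of the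
  rescaled points \<open>(z - \<mu>) / e\<close> of each cluster again have expansions, and one iterates.\<close>

text \<open>Nodes may coincide and the Wronskian matrices may be singular, so any of the limits may
  be 0: the argument must not divide by a leading coefficient or compare ratios of minors. The
  shifted determinant avoids this. Its factor \<open>1 + e^(1-2s) lam_i\<close> is of size
  \<open>e^(2i+1-2s)\<close> for \<open>i < s\<close> and tends to 1 for \<open>i >= s\<close>; the
  exponents \<open>1-2s, ..., -3, -1\<close> add up to \<open>-s^2\<close>, whence the prefactor
  \<open>e^(s^2)\<close>. The bound \<open>O(e^(2i))\<close> alone gives neither a limit nor an
  error term. Combined with an expansion to order \<open>2n\<close>, it forces the approximating
  polynomial to be divisible by \<open>e^(2i)\<close>, which yields both. Expansions of the power
  sums on one side of 0 would not be enough: \<open>sqrt e\<close> and \<open>- sqrt e\<close> have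
  power sums that are polynomials in \<open>e > 0\<close>. That the points stay real for both signs
  of \<open>e\<close> is what excludes such branches.\<close>

unbundle no inner_syntax

declare pderiv2.simps [simp del]

section \<open>Mixed Taylor expansion\<close>

text \<open>Exchange of derivatives, where the existence of the second mixed derivative is part of
  the conclusion. Write \<open>f u t\<close> as \<open>f u (-b)\<close> plus the integral of
  \<open>fy u\<close>, differentiate under the integral in \<open>u\<close>, and recover
  \<open>fxy\<close> by differentiating the resulting integral in its upper limit.\<close>

lemma has_real_derivative_mixed:
  fixes f fx fy fxy :: "real \<Rightarrow> real \<Rightarrow> real"
  assumes fy: "\<And>x y. \<lbrakk>\<bar>x\<bar> < a; \<bar>y\<bar> < a\<rbrakk> \<Longrightarrow> (f x has_real_derivative fy x y) (at y)"
    and fx: "\<And>x y. \<lbrakk>\<bar>x\<bar> < a; \<bar>y\<bar> < a\<rbrakk> \<Longrightarrow> ((\<lambda>t. f t y) has_real_derivative fx x y) (at x)"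
    and fyx: "\<And>x y. \<lbrakk>\<bar>x\<bar> < a; \<bar>y\<bar> < a\<rbrakk> \<Longrightarrow> ((\<lambda>t. fy t y) has_real_derivative fxy x y) (at x)"
    and cont_fy: "continuous_on ({-a<..<a} \<times> {-a<..<a}) (\<lambda>(x, y). fy x y)"
    and cont: "continuous_on ({-a<..<a} \<times> {-a<..<a}) (\<lambda>(x, y). fxy x y)"
    and x: "\<bar>x\<bar> < a" and y: "\<bar>y\<bar> < a"
  shows "(fx x has_real_derivative fxy x y) (at y)"
proof -
  \<comment> \<open>Any \<open>b\<close> strictly between \<open>\<bar>y\<bar>\<close> and
    \<open>a\<close> would do: the interval from \<open>-b\<close> to \<open>b\<close> lies in the
    domain and has \<open>y\<close> in its interior, and \<open>-b\<close> serves as base point of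
    the integrals.\<close>
  define b where "b = (\<bar>y\<bar> + a) / 2"
  have b: "\<bar>y\<bar> < b" "b < a" using y by (auto simp: b_def)
  let ?U = "{-a<..<a}"
  have cfy: "continuous_on {-b..t} (fy u)" if "\<bar>u\<bar> < a" "t \<le> b" for u t
    using that b
    by (auto intro!: continuous_on_compose2[OF cont_fy, of "{-b..t}" "\<lambda>s. (u, s)", simplified]
          continuous_on_Pair continuous_on_const continuous_on_id)
  have cfxy: "continuous_on {-b..t} (fxy u)" if "\<bar>u\<bar> < a" "t \<le> b" for u t
    using that b
    by (auto intro!: continuous_on_compose2[OF cont, of "{-b..t}" "\<lambda>s. (u, s)", simplified]
          continuous_on_Pair continuous_on_const continuous_on_id)
  have eq: "f u t = f u (-b) + integral {-b..t} (fy u)" if "\<bar>u\<bar> < a" "-b \<le> t" "t \<le> b" for u t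
  proof -
    have "(fy u has_integral (f u t - f u (-b))) {-b..t}"
      using that b
      by (intro fundamental_theorem_of_calculus)
         (auto intro!: has_field_derivative_at_within[OF fy] simp flip: has_real_derivative_iff_has_vector_derivative)
    then show ?thesis by (simp add: integral_unique)
  qed
  have eq': "fx x t = fx x (-b) + integral {-b..t} (fxy x)" if "-b \<le> t" "t \<le> b" for t
  proof -
    have "((\<lambda>u. integral (cbox (-b) t) (fy u)) has_field_derivative integral (cbox (-b) t) (fxy x)) (at x within ?U)"
    proof (rule leibniz_rule_field_derivative)
      show "continuous_on (?U \<times> cbox (-b) t) (\<lambda>(x, t). fxy x t)"
        using that b by (intro continuous_on_subset[OF cont]) auto
    qed (use that b x cfy in \<open>auto intro!: has_field_derivative_at_within[OF fyx] integrable_continuous_interval\<close>)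
    then have "((\<lambda>u. integral {-b..t} (fy u)) has_field_derivative integral {-b..t} (fxy x)) (at x)"
      using x by (subst (asm) at_within_open) auto
    then have d: "((\<lambda>u. f u (-b) + integral {-b..t} (fy u)) has_field_derivative fx x (-b) + integral {-b..t} (fxy x)) (at x)"
      using x b by (intro DERIV_add fx) auto
    have "\<forall>\<^sub>F u in nhds x. u \<in> ?U" using x by (intro eventually_nhds_in_open) auto
    then have "\<forall>\<^sub>F u in nhds x. f u (-b) + integral {-b..t} (fy u) = f u t"
      by eventually_elim (subst (2) eq, use that in auto)
    then have "((\<lambda>u. f u t) has_field_derivative fx x (-b) + integral {-b..t} (fxy x)) (at x)"
      using d by (subst (asm) DERIV_cong_ev[OF refl _ refl])
    moreover have "((\<lambda>u. f u t) has_field_derivative fx x t) (at x)" using x that b by (intro fx) auto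
    ultimately show ?thesis using DERIV_unique by blast
  qed
  have "((\<lambda>t. integral {-b..t} (fxy x)) has_real_derivative fxy x y) (at y within {-b..b})"
    using b cfxy x by (intro integral_has_real_derivative) auto
  then have "((\<lambda>t. integral {-b..t} (fxy x)) has_real_derivative fxy x y) (at y)"
    using b at_within_interior[of y "{-b..b}"] by (simp add: interior_atLeastAtMost_real abs_less_iff)
  then have d: "((\<lambda>t. fx x (-b) + integral {-b..t} (fxy x)) has_real_derivative 0 + fxy x y) (at y)"
    by (intro DERIV_add) auto
  have "\<forall>\<^sub>F t in nhds y. t \<in> {-b<..<b}" using b by (intro eventually_nhds_in_open) auto
  then have "\<forall>\<^sub>F t in nhds y. fx x (-b) + integral {-b..t} (fxy x) = fx x t"
    by eventually_elim (subst (2) eq', auto)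
  then show ?thesis using d by (subst (asm) DERIV_cong_ev[OF refl _ refl]) auto
qed

lemma C_ll_deriv_fst:
  assumes "C_ll n {-a<..<a} K" "i < n" "j \<le> n" "\<bar>x\<bar> < a" "\<bar>y\<bar> < a"
  shows "((\<lambda>t. pderiv2 K i j t y) has_real_derivative pderiv2 K (Suc i) j x y) (at x)"
  using assms unfolding C_ll_def by (auto simp: abs_less_iff)

lemma C_ll_continuous:
  assumes "C_ll n {-a<..<a} K" "i \<le> n" "j \<le> n"
  shows "continuous_on ({-a<..<a} \<times> {-a<..<a}) (\<lambda>(x, y). pderiv2 K i j x y)"
  using assms unfolding C_ll_def by blast

text \<open>\<open>pderiv2\<close> takes all \<open>y\<close>-derivatives before any
  \<open>x\<close>-derivative, and \<open>C_ll\<close> records \<open>y\<close>-differentiability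
  only for \<open>i = 0\<close>. Induction on \<open>i\<close> carries it past each further
  \<open>x\<close>-derivative by the exchange lemma.\<close>

lemma C_ll_deriv_snd:
  assumes K: "C_ll n {-a<..<a} K" and "i \<le> n" "j < n" "\<bar>x\<bar> < a" "\<bar>y\<bar> < a"
  shows "(pderiv2 K i j x has_real_derivative pderiv2 K i (Suc j) x y) (at y)"
  using assms(2-)
proof (induction i arbitrary: x y)
  case 0
  with K show ?case unfolding C_ll_def by (auto simp: abs_less_iff)
next
  case (Suc i)
  show ?case
    by (rule has_real_derivative_mixed[where f = "pderiv2 K i j" and fy = "pderiv2 K i (Suc j)"
          and fx = "pderiv2 K (Suc i) j" and fxy = "pderiv2 K (Suc i) (Suc j)" and a = a])
       (use Suc in \<open>auto intro!: C_ll_deriv_fst[OF K] C_ll_continuous[OF K]\<close>)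
qed

text \<open>A functional annihilating polynomials of degree below \<open>i\<close> sees only the Taylor remainder of
  order \<open>i\<close>; using this in both variables produces the factor \<open>e ^ (i + j)\<close>.\<close>

lemma annihilating_sum_Taylor:
  fixes x c :: "nat \<Rightarrow> real"
  assumes c: "\<And>k. k < m \<Longrightarrow> (\<Sum>l<n. c l * x l ^ k) = 0"
    and d: "\<And>k l t. \<lbrakk>k < m; l < n; \<bar>t\<bar> \<le> \<bar>e * x l\<bar>\<rbrakk> \<Longrightarrow> (diff k has_real_derivative diff (Suc k) t) (at t)"
  shows "\<exists>\<xi>. (\<forall>l<n. \<bar>\<xi> l\<bar> \<le> \<bar>e * x l\<bar>) \<and>
    (\<Sum>l<n. c l * diff 0 (e * x l)) = e ^ m * (\<Sum>l<n. c l * x l ^ m * (diff m (\<xi> l) / fact m))"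
proof -
  have "\<exists>t. \<bar>t\<bar> \<le> \<bar>e * x l\<bar> \<and>
      diff 0 (e * x l) = (\<Sum>k<m. diff k 0 / fact k * (e * x l) ^ k) + diff m t / fact m * (e * x l) ^ m"
    if "l < n" for l
    using d that by (intro Maclaurin_bi_le) auto
  then have "\<forall>l\<in>{..<n}. \<exists>t. \<bar>t\<bar> \<le> \<bar>e * x l\<bar> \<and>
      diff 0 (e * x l) = (\<Sum>k<m. diff k 0 / fact k * (e * x l) ^ k) + diff m t / fact m * (e * x l) ^ m"
    by simp
  from bchoice[OF this] obtain \<xi> where \<xi>: "\<And>l. l < n \<Longrightarrow> \<bar>\<xi> l\<bar> \<le> \<bar>e * x l\<bar>"
    "\<And>l. l < n \<Longrightarrow> diff 0 (e * x l) =
       (\<Sum>k<m. diff k 0 / fact k * (e * x l) ^ k) + diff m (\<xi> l) / fact m * (e * x l) ^ m"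
    by auto
  have "(\<Sum>l<n. c l * (\<Sum>k<m. diff k 0 / fact k * (e * x l) ^ k)) =
      (\<Sum>k<m. diff k 0 / fact k * e ^ k * (\<Sum>l<n. c l * x l ^ k))"
    unfolding sum_distrib_left by (subst sum.swap) (simp add: mult_ac power_mult_distrib)
  also have "\<dots> = 0" by (simp add: c)
  finally have "(\<Sum>l<n. c l * diff 0 (e * x l)) = e ^ m * (\<Sum>l<n. c l * x l ^ m * (diff m (\<xi> l) / fact m))"
    by (simp add: \<xi>(2) ring_distribs sum.distrib sum_distrib_left power_mult_distrib mult_ac)
  with \<xi>(1) show ?thesis by blast
qed

lemma annihilating_form_mixed_Taylor:
  fixes x c d :: "nat \<Rightarrow> real"
  assumes K: "C_ll n {-a<..<a} K" and ij: "i \<le> n" "j \<le> n" and small: "\<And>l. l < n \<Longrightarrow> \<bar>e * x l\<bar> < a"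
    and c: "\<And>k. k < i \<Longrightarrow> (\<Sum>l<n. c l * x l ^ k) = 0"
    and d: "\<And>k. k < j \<Longrightarrow> (\<Sum>l<n. d l * x l ^ k) = 0"
  shows "\<exists>\<xi> \<eta>. (\<forall>p<n. \<forall>q<n. \<bar>\<xi> p q\<bar> \<le> \<bar>e * x p\<bar> \<and> \<bar>\<eta> p q\<bar> \<le> \<bar>e * x q\<bar>) \<and>
    (\<Sum>p<n. \<Sum>q<n. c p * d q * K (e * x p) (e * x q)) =
    e ^ (i + j) * (\<Sum>p<n. \<Sum>q<n. c p * x p ^ i * (d q * x q ^ j) *
      (pderiv2 K i j (\<xi> p q) (\<eta> p q) / (fact i * fact j)))"
proof -
  \<comment> \<open>\<open>?G k\<close> is the \<open>k\<close>-th \<open>x\<close>-derivative,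
    already summed against \<open>d\<close> in the second variable. Expanding it in \<open>x\<close>
    first gives points \<open>\<xi> p\<close> independent of \<open>q\<close>; the
    \<open>y\<close>-expansion is then made on the line \<open>x = \<xi> p\<close>, separately for
    each \<open>p\<close>.\<close>
  let ?G = "\<lambda>k t. \<Sum>q<n. d q * pderiv2 K k 0 t (e * x q)"
  have "\<exists>\<xi>. (\<forall>p<n. \<bar>\<xi> p\<bar> \<le> \<bar>e * x p\<bar>) \<and>
    (\<Sum>p<n. c p * ?G 0 (e * x p)) = e ^ i * (\<Sum>p<n. c p * x p ^ i * (?G i (\<xi> p) / fact i))"
  proof (rule annihilating_sum_Taylor[OF c])
    fix k l t assume k: "k < i" "l < n" "\<bar>t\<bar> \<le> \<bar>e * x l\<bar>"
    with small[of l] have "\<bar>t\<bar> < a" by linarith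
    with k ij show "(?G k has_real_derivative ?G (Suc k) t) (at t)"
      by (auto intro!: DERIV_sum DERIV_cmult C_ll_deriv_fst[OF K] small)
  qed
  then obtain \<xi> where \<xi>: "\<And>p. p < n \<Longrightarrow> \<bar>\<xi> p\<bar> \<le> \<bar>e * x p\<bar>"
    "(\<Sum>p<n. c p * ?G 0 (e * x p)) = e ^ i * (\<Sum>p<n. c p * x p ^ i * (?G i (\<xi> p) / fact i))" by blast
  have \<xi>a: "\<bar>\<xi> p\<bar> < a" if "p < n" for p using \<xi>(1)[OF that] small[OF that] by linarith
  have "\<exists>\<eta>. (\<forall>q<n. \<bar>\<eta> q\<bar> \<le> \<bar>e * x q\<bar>) \<and>
    ?G i (\<xi> p) = e ^ j * (\<Sum>q<n. d q * x q ^ j * (pderiv2 K i j (\<xi> p) (\<eta> q) / fact j))" if p: "p < n" for p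
  proof (rule annihilating_sum_Taylor[OF d, where diff = "\<lambda>k. pderiv2 K i k (\<xi> p)"])
    fix k l t assume k: "k < j" "l < n" "\<bar>t\<bar> \<le> \<bar>e * x l\<bar>"
    with small[of l] have "\<bar>t\<bar> < a" by linarith
    with k ij \<xi>a[OF p] show "(pderiv2 K i k (\<xi> p) has_real_derivative pderiv2 K i (Suc k) (\<xi> p) t) (at t)"
      by (auto intro!: C_ll_deriv_snd[OF K])
  qed
  then have "\<forall>p\<in>{..<n}. \<exists>\<eta>. (\<forall>q<n. \<bar>\<eta> q\<bar> \<le> \<bar>e * x q\<bar>) \<and>
    ?G i (\<xi> p) = e ^ j * (\<Sum>q<n. d q * x q ^ j * (pderiv2 K i j (\<xi> p) (\<eta> q) / fact j))" by simp
  from bchoice[OF this] obtain \<eta> where \<eta>: "\<And>p q. \<lbrakk>p < n; q < n\<rbrakk> \<Longrightarrow> \<bar>\<eta> p q\<bar> \<le> \<bar>e * x q\<bar>"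
    "\<And>p. p < n \<Longrightarrow> ?G i (\<xi> p) = e ^ j * (\<Sum>q<n. d q * x q ^ j * (pderiv2 K i j (\<xi> p) (\<eta> p q) / fact j))"
    by auto
  show ?thesis
  proof (rule exI[of _ "\<lambda>p q. \<xi> p"], rule exI[of _ \<eta>], rule conjI)
    have "(\<Sum>p<n. \<Sum>q<n. c p * d q * K (e * x p) (e * x q)) = (\<Sum>p<n. c p * ?G 0 (e * x p))"
      by (simp add: sum_distrib_left mult_ac pderiv2.simps)
    also have "\<dots> = e ^ i * (\<Sum>p<n. c p * x p ^ i *
        ((e ^ j * (\<Sum>q<n. d q * x q ^ j * (pderiv2 K i j (\<xi> p) (\<eta> p q) / fact j))) / fact i))"
      unfolding \<xi>(2) by (intro arg_cong[where f = "\<lambda>u. e ^ i * u"] sum.cong refl) (simp add: \<eta>(2))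
    also have "\<dots> = e ^ (i + j) * (\<Sum>p<n. \<Sum>q<n. c p * x p ^ i * (d q * x q ^ j) *
      (pderiv2 K i j (\<xi> p) (\<eta> p q) / (fact i * fact j)))"
      by (simp add: sum_distrib_left sum_divide_distrib power_add mult_ac)
    finally show "(\<Sum>p<n. \<Sum>q<n. c p * d q * K (e * x p) (e * x q)) =
      e ^ (i + j) * (\<Sum>p<n. \<Sum>q<n. c p * x p ^ i * (d q * x q ^ j) *
      (pderiv2 K i j (\<xi> p) (\<eta> p q) / (fact i * fact j)))" .
  qed (use \<xi>(1) \<eta>(1) in auto)
qed

text \<open>After division by \<open>e ^ (i + j)\<close> only derivatives at intermediate points
  remain. These points are squeezed to the origin, where the derivative is continuous, and the
  limiting double sum factors into two moments.\<close>

lemma annihilating_form_limit: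
  fixes x c d :: "nat \<Rightarrow> real"
  assumes K: "C_ll n {-a<..<a} K" and "a > 0" and ij: "i \<le> n" "j \<le> n"
    and c: "\<And>k. k < i \<Longrightarrow> (\<Sum>l<n. c l * x l ^ k) = 0"
    and d: "\<And>k. k < j \<Longrightarrow> (\<Sum>l<n. d l * x l ^ k) = 0"
  shows "((\<lambda>e. (\<Sum>p<n. \<Sum>q<n. c p * d q * K (e * x p) (e * x q)) / e ^ (i + j)) \<longlongrightarrow>
    (\<Sum>l<n. c l * x l ^ i) * (\<Sum>l<n. d l * x l ^ j) * (pderiv2 K i j 0 0 / (fact i * fact j))) (at_right 0)"
proof -
  let ?P = "\<lambda>e \<xi> \<eta>. (\<forall>p<n. \<forall>q<n. \<bar>\<xi> p q\<bar> \<le> \<bar>e * x p\<bar> \<and> \<bar>\<eta> p q\<bar> \<le> \<bar>e * x q\<bar>) \<and>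
    (\<Sum>p<n. \<Sum>q<n. c p * d q * K (e * x p) (e * x q)) =
    e ^ (i + j) * (\<Sum>p<n. \<Sum>q<n. c p * x p ^ i * (d q * x q ^ j) *
      (pderiv2 K i j (\<xi> p q) (\<eta> p q) / (fact i * fact j)))"
  have "\<forall>\<^sub>F e in at_right 0. \<bar>e * x l\<bar> < a" for l
  proof (rule order_tendstoD)
    show "((\<lambda>e. \<bar>e * x l\<bar>) \<longlongrightarrow> \<bar>0 * x l\<bar>) (at_right 0)" by (intro tendsto_intros)
  qed (use \<open>a > 0\<close> in auto)
  then have "\<forall>\<^sub>F e in at_right 0. \<forall>l\<in>{..<n}. \<bar>e * x l\<bar> < a" by (intro eventually_ball_finite) auto
  then have "\<forall>\<^sub>F e in at_right 0. \<exists>\<xi> \<eta>. ?P e \<xi> \<eta>"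
  proof eventually_elim
    case (elim e)
    then have "\<And>l. l < n \<Longrightarrow> \<bar>e * x l\<bar> < a" by auto
    from annihilating_form_mixed_Taylor[OF K ij this c d] show ?case by simp
  qed
  then obtain \<xi> \<eta> where ev: "\<forall>\<^sub>F e in at_right 0. ?P e (\<xi> e) (\<eta> e)"
    unfolding eventually_ex by blast
  have lim: "((\<lambda>e. \<bar>e * x p\<bar>) \<longlongrightarrow> 0) (at_right 0)" for p
    by (rule tendsto_eq_intros refl)+ simp
  have lims: "((\<lambda>e. \<xi> e p q) \<longlongrightarrow> 0) (at_right 0)" "((\<lambda>e. \<eta> e p q) \<longlongrightarrow> 0) (at_right 0)" if "p < n" "q < n" for p q
    by (rule tendsto_0_le[OF lim, where K = 1]; use ev in eventually_elim; use that in auto)+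
  have "((\<lambda>e. pderiv2 K i j (\<xi> e p q) (\<eta> e p q)) \<longlongrightarrow> pderiv2 K i j 0 0) (at_right 0)" if "p < n" "q < n" for p q
  proof -
    have "isCont (\<lambda>(x, y). pderiv2 K i j x y) (0, 0)"
      using C_ll_continuous[OF K ij] \<open>a > 0\<close>
      by (intro continuous_on_interior) (auto simp: interior_open open_Times)
    moreover have "((\<lambda>e. (\<xi> e p q, \<eta> e p q)) \<longlongrightarrow> (0, 0)) (at_right 0)"
      using lims[OF that] by (intro tendsto_Pair)
    ultimately show ?thesis by (auto dest!: isCont_tendsto_compose)
  qed
  then have "((\<lambda>e. \<Sum>p<n. \<Sum>q<n. c p * x p ^ i * (d q * x q ^ j) *
      (pderiv2 K i j (\<xi> e p q) (\<eta> e p q) / (fact i * fact j))) \<longlongrightarrow>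
     (\<Sum>p<n. \<Sum>q<n. c p * x p ^ i * (d q * x q ^ j) * (pderiv2 K i j 0 0 / (fact i * fact j)))) (at_right 0)"
    by (intro tendsto_intros) auto
  moreover have "\<forall>\<^sub>F e in at_right 0. (\<Sum>p<n. \<Sum>q<n. c p * x p ^ i * (d q * x q ^ j) *
      (pderiv2 K i j (\<xi> e p q) (\<eta> e p q) / (fact i * fact j))) =
      (\<Sum>p<n. \<Sum>q<n. c p * d q * K (e * x p) (e * x q)) / e ^ (i + j)"
    using ev eventually_at_right_less[of 0] by eventually_elim simp
  ultimately have "((\<lambda>e. (\<Sum>p<n. \<Sum>q<n. c p * d q * K (e * x p) (e * x q)) / e ^ (i + j)) \<longlongrightarrow>
     (\<Sum>p<n. \<Sum>q<n. c p * x p ^ i * (d q * x q ^ j) * (pderiv2 K i j 0 0 / (fact i * fact j)))) (at_right 0)"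
    by (rule Lim_transform_eventually)
  also have "(\<Sum>p<n. \<Sum>q<n. c p * x p ^ i * (d q * x q ^ j) * (pderiv2 K i j 0 0 / (fact i * fact j))) =
    (\<Sum>l<n. c l * x l ^ i) * (\<Sum>l<n. d l * x l ^ j) * (pderiv2 K i j 0 0 / (fact i * fact j))"
    by (subst sum_product) (simp add: sum_distrib_right sum_divide_distrib)
  finally show ?thesis .
qed

section \<open>Symmetric matrices\<close>

definition ortho_mat :: "nat \<Rightarrow> real mat \<Rightarrow> bool" where
  "ortho_mat n U \<longleftrightarrow> U \<in> carrier_mat n n \<and> transpose_mat U * U = 1\<^sub>m n"

lemma ortho_matD:
  assumes "ortho_mat n U"
  shows "U \<in> carrier_mat n n" "transpose_mat U * U = 1\<^sub>m n" "U * transpose_mat U = 1\<^sub>m n"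
  using assms mat_mult_left_right_inverse[of "transpose_mat U" n U] by (auto simp: ortho_mat_def)

lemma ortho_mat_mult:
  assumes U: "ortho_mat n U" and V: "ortho_mat n V"
  shows "ortho_mat n (U * V)"
proof -
  note U = ortho_matD[OF U] and V = ortho_matD[OF V]
  have "transpose_mat (U * V) * (U * V) = transpose_mat V * transpose_mat U * (U * V)"
    using U V by (subst Matrix.transpose_mult[of U n n V n]) auto
  also have "\<dots> = transpose_mat V * ((transpose_mat U * U) * V)"
    using U(1) V(1) by (auto simp: assoc_mult_mat[of _ n n _ n _ n])
  also have "\<dots> = 1\<^sub>m n" using U V by auto
  finally show ?thesis using U V by (auto simp: ortho_mat_def)
qed

text \<open>Fewer than \<open>n\<close> linear conditions leave a nonzero solution: filling up with
  zero rows gives a singular square matrix, and a kernel vector is normalised.\<close>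

lemma unit_vector_orthogonal:
  fixes c :: "nat \<Rightarrow> real vec"
  assumes "m < n" "\<And>i. i < m \<Longrightarrow> c i \<in> carrier_vec n"
  shows "\<exists>v \<in> carrier_vec n. v \<bullet> v = 1 \<and> (\<forall>i<m. c i \<bullet> v = 0)"
proof -
  define M where "M = mat n n (\<lambda>(i, j). if i < m then c i $ j else 0)"
  have M: "M \<in> carrier_mat n n" by (auto simp: M_def)
  define r where "r = (\<lambda>i. if i < m then c i else 0\<^sub>v n)"
  have "M = mat\<^sub>r n n (\<lambda>i. if i = n - 1 then 0\<^sub>v n else r i)"
    using assms by (intro eq_matI) (auto simp: M_def r_def)
  then have "det M = 0" using assms by (simp only:, intro det_row_0) (auto simp: r_def)
  then obtain v where v: "v \<in> carrier_vec n" "v \<noteq> 0\<^sub>v n" "M *\<^sub>v v = 0\<^sub>v n"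
    using det_0_iff_vec_prod_zero_field[OF M] by blast
  have cv: "c i \<bullet> v = 0" if "i < m" for i
  proof -
    have "row M i = c i" using that assms(1) assms(2)[OF that] by (intro eq_vecI) (auto simp: M_def)
    then have "c i \<bullet> v = (M *\<^sub>v v) $ i" using that assms M by (subst index_mult_mat_vec) auto
    with v(3) that assms show ?thesis by simp
  qed
  have pos: "v \<bullet> v > 0"
  proof -
    obtain k where k: "k < n" "v $ k \<noteq> 0"
      using v(1,2) by (metis carrier_vecD eq_vecI index_zero_vec)
    have "0 < (v $ k)\<^sup>2" using k by simp
    also have "\<dots> \<le> (\<Sum>i = 0..<n. (v $ i)\<^sup>2)" using k by (intro member_le_sum) auto
    also have "\<dots> = v \<bullet> v" using v(1) by (simp add: scalar_prod_def power2_eq_square)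
    finally show ?thesis .
  qed
  let ?t = "1 / sqrt (v \<bullet> v)"
  show ?thesis
  proof (intro bexI conjI allI impI)
    show "(?t \<cdot>\<^sub>v v) \<bullet> (?t \<cdot>\<^sub>v v) = 1" using v(1) pos
      by (simp add: smult_scalar_prod_distrib[of _ n] scalar_prod_smult_distrib[of _ n])
    show "c i \<bullet> (?t \<cdot>\<^sub>v v) = 0" if "i < m" for i
      using cv[OF that] assms(2)[OF that] v(1) by (simp add: scalar_prod_smult_distrib[of _ n])
  qed (use v in auto)
qed

text \<open>The vectors are chosen from the last index downwards. At stage \<open>m\<close> there
  are \<open>m\<close> conditions from the \<open>c\<close> and \<open>n - 1 - m\<close> from the
  later \<open>q\<close>, so \<open>n - 1\<close> in all. Unlike Gram-Schmidt this never needs the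
  \<open>c\<close> to be independent, so coinciding nodes are covered.\<close>

lemma orthonormal_triangular:
  fixes c :: "nat \<Rightarrow> real vec"
  assumes "\<And>i. i < n \<Longrightarrow> c i \<in> carrier_vec n" "m \<le> n"
  shows "\<exists>q. (\<forall>i. m \<le> i \<and> i < n \<longrightarrow> q i \<in> carrier_vec n \<and> (\<forall>j<i. c j \<bullet> q i = 0) \<and>
    (\<forall>j. m \<le> j \<and> j < n \<longrightarrow> q i \<bullet> q j = (if i = j then 1 else (0 :: real))))"
  using assms(2)
proof (induction m rule: inc_induct)
  case base
  then show ?case by auto
next
  case (step m)
  then obtain q where q: "\<And>i. Suc m \<le> i \<Longrightarrow> i < n \<Longrightarrow> q i \<in> carrier_vec n"
    "\<And>i j. Suc m \<le> i \<Longrightarrow> i < n \<Longrightarrow> j < i \<Longrightarrow> c j \<bullet> q i = 0"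
    "\<And>i j. Suc m \<le> i \<Longrightarrow> i < n \<Longrightarrow> Suc m \<le> j \<Longrightarrow> j < n \<Longrightarrow> q i \<bullet> q j = (if i = j then 1 else 0)"
    by blast
  \<comment> \<open>\<open>d\<close> enumerates the \<open>n - 1\<close> conditions:
    \<open>c i\<close> for \<open>i < m\<close>, then the later \<open>q\<close>, shifted down by
    one index to fill the gap at \<open>m\<close>.\<close>
  define d where "d = (\<lambda>i. if i < m then c i else q (Suc i))"
  have "\<exists>v \<in> carrier_vec n. v \<bullet> v = 1 \<and> (\<forall>i<n - 1. d i \<bullet> v = 0)"
    using step.hyps q(1) assms(1) by (intro unit_vector_orthogonal) (auto simp: d_def)
  then obtain v where v: "v \<in> carrier_vec n" "v \<bullet> v = 1" "\<And>i. i < n - 1 \<Longrightarrow> d i \<bullet> v = 0" by blast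
  have vc: "c j \<bullet> v = 0" if "j < m" for j using v(3)[of j] that step.hyps by (auto simp: d_def)
  have vq: "q j \<bullet> v = 0" if "m < j" "j < n" for j using v(3)[of "j - 1"] that by (cases j) (auto simp: d_def)
  then have vq': "v \<bullet> q j = 0" if "m < j" "j < n" for j
    using comm_scalar_prod[of v n "q j"] q(1)[of j] v(1) that by auto
  show ?case
    by (rule exI[of _ "q(m := v)"]) (use q v vc vq vq' in \<open>auto simp: Suc_le_eq\<close>)
qed

lemma ortho_mat_triangular:
  fixes c :: "nat \<Rightarrow> real vec"
  assumes "\<And>i. i < n \<Longrightarrow> c i \<in> carrier_vec n"
  shows "\<exists>Q. ortho_mat n Q \<and> (\<forall>i<n. \<forall>j<i. c j \<bullet> col Q i = 0)"
proof -
  obtain q where q0: "\<forall>i. 0 \<le> i \<and> i < n \<longrightarrow> q i \<in> carrier_vec n \<and> (\<forall>j<i. c j \<bullet> q i = 0) \<and>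
    (\<forall>j. 0 \<le> j \<and> j < n \<longrightarrow> q i \<bullet> q j = (if i = j then 1 else 0))"
    using orthonormal_triangular[of n c 0] assms by blast
  have q: "\<And>i. i < n \<Longrightarrow> q i \<in> carrier_vec n"
    "\<And>i j. i < n \<Longrightarrow> j < i \<Longrightarrow> c j \<bullet> q i = 0"
    "\<And>i j. i < n \<Longrightarrow> j < n \<Longrightarrow> q i \<bullet> q j = (if i = j then 1 else 0)"
    using q0 by auto
  define Q where "Q = mat n n (\<lambda>(i, j). q j $ i)"
  have col: "col Q i = q i" if "i < n" for i using q(1)[OF that] that by (intro eq_vecI) (auto simp: Q_def)
  have "transpose_mat Q * Q = 1\<^sub>m n"
    by (rule eq_matI) (auto simp: Q_def[THEN arg_cong[of _ _ dim_col]] Q_def[THEN arg_cong[of _ _ dim_row]] col q(3))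
  with col q(2) show ?thesis by (intro exI[of _ Q]) (auto simp: ortho_mat_def Q_def)
qed

section \<open>Diagonalisation of real symmetric matrices\<close>

lemma similar_ortho_conj:
  assumes "ortho_mat n U" "A \<in> carrier_mat n n"
  shows "similar_mat A (transpose_mat U * A * U)"
proof -
  note U = ortho_matD[OF assms(1)]
  have "U * (transpose_mat U * A * U) * transpose_mat U = (U * transpose_mat U) * A * (U * transpose_mat U)"
    using U(1) assms(2) by (auto simp: assoc_mult_mat[of _ n n _ n _ n])
  also have "\<dots> = A" using U assms(2) by auto
  finally have "similar_mat_wit A (transpose_mat U * A * U) U (transpose_mat U)"
    using U assms(2) by (intro similar_mat_witI[of _ _ n]) auto
  then show ?thesis unfolding similar_mat_def by blast
qed

lemma symmetric_ortho_conj: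
  fixes U A :: "real mat"
  assumes U: "U \<in> carrier_mat n m" and A: "A \<in> carrier_mat n n" and sym: "transpose_mat A = A"
  shows "transpose_mat (transpose_mat U * A * U) = transpose_mat U * A * U"
proof -
  have "transpose_mat (transpose_mat U * A * U) = transpose_mat U * transpose_mat (transpose_mat U * A)"
    using U A by (intro Matrix.transpose_mult[of _ m n _ m]) auto
  also have "transpose_mat (transpose_mat U * A) = transpose_mat A * transpose_mat (transpose_mat U)"
    using U A by (intro Matrix.transpose_mult[of _ m n _ n]) auto
  finally show ?thesis using U A sym by (auto simp: assoc_mult_mat[of _ m n _ n _ m])
qed

text \<open>Deflation: an orthogonal matrix adapted to one eigenvector splits off a one-by-one
  block, and the induction continues with the rest. The order of \<open>es\<close> is kept on the
  diagonal, so eigenvalues listed in decreasing order retain their labels.\<close>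

lemma spectral_decomposition:
  fixes A :: "real mat"
  assumes "A \<in> carrier_mat n n" "transpose_mat A = A" "char_poly A = (\<Prod>e\<leftarrow>es. [:- e, 1:])" "length es = n"
  shows "\<exists>U. ortho_mat n U \<and> transpose_mat U * A * U = mat_diag n ((!) es)"
  using assms
proof (induction es arbitrary: n A)
  case Nil
  then show ?case by (intro exI[of _ "1\<^sub>m 0"]) (auto simp: ortho_mat_def mat_diag_def)
next
  case (Cons e es)
  define m where "m = length es"
  have n: "n = Suc m" using Cons.prems by (simp add: m_def)
  note A = \<open>A \<in> carrier_mat n n\<close>
  have "poly (char_poly A) e = 0" using Cons.prems by simp
  then obtain v where v: "v \<in> carrier_vec n" "v \<noteq> 0\<^sub>v n" "A *\<^sub>v v = e \<cdot>\<^sub>v v"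
    using eigenvalue_root_char_poly[OF A] A by (auto simp: eigenvalue_def eigenvector_def)
  obtain Q where Q: "ortho_mat n Q" "\<And>i. i < n \<Longrightarrow> i > 0 \<Longrightarrow> v \<bullet> col Q i = 0"
    using ortho_mat_triangular[of n "\<lambda>_. v"] v(1) by blast
  note Q' = ortho_matD[OF Q(1)]
  define B where "B = transpose_mat Q * A * Q"
  have B: "B \<in> carrier_mat n n" using Q' A by (auto simp: B_def)
  have symB: "transpose_mat B = B" unfolding B_def using Q' A Cons.prems by (intro symmetric_ortho_conj) auto
  \<comment> \<open>every column of \<open>Q\<close> but the first is orthogonal to \<open>v\<close>, so \<open>v\<close> is a multiple of the first\<close>
  define w where "w = transpose_mat Q *\<^sub>v v"
  have w: "w \<in> carrier_vec n" using Q' v by (auto simp: w_def)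
  have wi: "w $ i = 0" if "0 < i" "i < n" for i
    using Q(2)[of i] that Q' v comm_scalar_prod[of v n "col Q i"] by (auto simp: w_def)
  have Qw: "Q *\<^sub>v w = v" unfolding w_def using Q' v by (subst assoc_mult_mat_vec[symmetric, of _ n n _ n]) auto
  have w0: "w $ 0 \<noteq> 0"
  proof
    assume "w $ 0 = 0"
    then have "w $ i = 0" if "i < n" for i using wi[of i] that by (cases i) auto
    then have "w = 0\<^sub>v n" using w by (intro eq_vecI) auto
    then have "Q *\<^sub>v w = 0\<^sub>v n" using Q'(1) by (intro eq_vecI) auto
    with Qw v(2) show False by simp
  qed
  have Bw: "B *\<^sub>v w = e \<cdot>\<^sub>v w"
  proof -
    have "B *\<^sub>v w = (transpose_mat Q * A) *\<^sub>v (Q *\<^sub>v w)"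
      unfolding B_def using Q'(1) A w by (intro assoc_mult_mat_vec[of _ n n _ n]) auto
    also have "\<dots> = transpose_mat Q *\<^sub>v (A *\<^sub>v (Q *\<^sub>v w))"
      using Q'(1) A w by (intro assoc_mult_mat_vec[of _ n n _ n]) auto
    also have "\<dots> = transpose_mat Q *\<^sub>v (e \<cdot>\<^sub>v v)" by (simp only: Qw v(3))
    also have "\<dots> = e \<cdot>\<^sub>v w" unfolding w_def using Q'(1) v(1) by (intro mult_mat_vec[of _ n n]) auto
    finally show ?thesis .
  qed
  \<comment> \<open>Since the eigenvector \<open>w\<close> of \<open>B\<close> is a multiple of the
    first unit vector, it determines the first column of \<open>B\<close>; symmetry then clears the
    first row.\<close>
  have Bi0: "B $$ (i, 0) = (if i = 0 then e else 0)" if "i < n" for i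
  proof -
    have "(B *\<^sub>v w) $ i = (\<Sum>j = 0..<n. B $$ (i, j) * w $ j)"
      using B w that by (auto simp: scalar_prod_def)
    also have "\<dots> = (\<Sum>j\<in>{0}. B $$ (i, j) * w $ j)"
      using wi n by (intro sum.mono_neutral_right) auto
    finally have "B $$ (i, 0) * w $ 0 = e * w $ i" using Bw w that by simp
    with w0 wi[of i] that show ?thesis by auto
  qed
  have B0i: "B $$ (0, i) = (if i = 0 then e else 0)" if "i < n" for i
    using Bi0[OF that] arg_cong[OF symB, of "\<lambda>M. M $$ (i, 0)"] B that n by simp
  define C where "C = mat m m (\<lambda>(i, j). B $$ (Suc i, Suc j))"
  have C: "C \<in> carrier_mat m m" by (simp add: C_def)
  have Bblock: "B = four_block_mat (mat 1 1 (\<lambda>_. e)) (0\<^sub>m 1 m) (0\<^sub>m m 1) C"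
    using B n Bi0 B0i by (intro eq_matI) (auto simp: C_def less_Suc_eq_0_disj)
  have symC: "transpose_mat C = C"
  proof (rule eq_matI)
    fix i j assume "i < dim_row C" "j < dim_col C"
    then show "transpose_mat C $$ (i, j) = C $$ (i, j)"
      using arg_cong[OF symB, of "\<lambda>M. M $$ (Suc i, Suc j)"] B n by (auto simp: C_def)
  qed (auto simp: C_def)
  have "char_poly A = char_poly B"
    unfolding B_def by (intro char_poly_similar similar_ortho_conj[OF Q(1) A])
  also have "\<dots> = char_poly (mat 1 1 (\<lambda>_. e)) * char_poly C"
    unfolding Bblock using C by (intro char_poly_four_block_zeros_col) auto
  also have "char_poly (mat 1 1 (\<lambda>_. e)) = [:- e, 1:]"
    by (simp add: char_poly_defs det_single)
  finally have "[:- e, 1:] * char_poly C = [:- e, 1:] * (\<Prod>e\<leftarrow>es. [:- e, 1:])"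
    using Cons.prems by simp
  then have "char_poly C = (\<Prod>e\<leftarrow>es. [:- e, 1:])" by (subst (asm) mult_cancel_left) auto
  from Cons.IH[OF C symC this] obtain V where
    V: "ortho_mat m V" "transpose_mat V * C * V = mat_diag m ((!) es)" by (auto simp: m_def)
  note V' = ortho_matD[OF V(1)]
  define W where "W = four_block_mat (1\<^sub>m 1) (0\<^sub>m 1 m) (0\<^sub>m m 1) V"
  have W: "W \<in> carrier_mat n n" using V' n by (auto simp: W_def)
  have tW: "transpose_mat W = four_block_mat (1\<^sub>m 1) (0\<^sub>m 1 m) (0\<^sub>m m 1) (transpose_mat V)"
    unfolding W_def using V' by (subst transpose_four_block_mat[of _ 1 1 _ m _ m]) auto
  have "transpose_mat W * W = four_block_mat (1\<^sub>m 1) (0\<^sub>m 1 m) (0\<^sub>m m 1) (1\<^sub>m m)"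
    unfolding tW unfolding W_def using V'
    by (subst mult_four_block_mat[of _ 1 1 _ m _ m _ _ 1 _ m]) auto
  also have "\<dots> = 1\<^sub>m n" using n by (intro eq_matI) auto
  finally have oW: "ortho_mat n W" using W by (simp add: ortho_mat_def)
  have "transpose_mat W * B = four_block_mat (mat 1 1 (\<lambda>_. e)) (0\<^sub>m 1 m) (0\<^sub>m m 1) (transpose_mat V * C)"
    unfolding tW Bblock using V' C by (subst mult_four_block_mat[of _ 1 1 _ m _ m _ _ 1 _ m]) auto
  then have "transpose_mat W * B * W = four_block_mat (mat 1 1 (\<lambda>_. e)) (0\<^sub>m 1 m) (0\<^sub>m m 1) (transpose_mat V * C * V)"
    unfolding W_def using V' C by (simp, subst mult_four_block_mat[of _ 1 1 _ m _ m _ _ 1 _ m]) auto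
  also have "\<dots> = mat_diag n ((!) (e # es))"
    unfolding V(2) using n by (intro eq_matI) (auto simp: mat_diag_def nth_Cons')
  finally have "transpose_mat W * B * W = mat_diag n ((!) (e # es))" .
  moreover have "transpose_mat (Q * W) * A * (Q * W) = transpose_mat W * B * W"
  proof -
    have "transpose_mat (Q * W) = transpose_mat W * transpose_mat Q"
      using Q' W by (intro Matrix.transpose_mult[of _ n n _ n]) auto
    then show ?thesis unfolding B_def using Q' W A by (auto simp: assoc_mult_mat[of _ n n _ n _ n])
  qed
  ultimately show ?case using ortho_mat_mult[OF Q(1) oW] by (intro exI[of _ "Q * W"]) auto
qed

text \<open>Over the complex numbers the polynomial splits anyway. For an eigenvector
  \<open>v\<close> of \<open>a\<close>, the Hermitian form \<open>S\<close> at \<open>v\<close> is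
  real by symmetry and equals \<open>a\<close> times a positive real, so every root is real.\<close>

lemma symmetric_char_poly_splits:
  fixes A :: "real mat"
  assumes A: "A \<in> carrier_mat n n" and sym: "transpose_mat A = A"
  shows "\<exists>es. char_poly A = (\<Prod>e\<leftarrow>es. [:- e, 1:]) \<and> length es = n"
proof -
  let ?c = "of_real :: real \<Rightarrow> complex"
  interpret c: map_poly_inj_idom_hom ?c ..
  define B where "B = map_mat ?c A"
  have B: "B \<in> carrier_mat n n" using A by (simp add: B_def)
  obtain as where as: "char_poly B = (\<Prod>a\<leftarrow>as. [:- a, 1:])" "length as = n"
    using char_poly_factorized[OF B] by blast
  have real: "Im a = 0" if "a \<in> set as" for a
  proof -
    have "poly (char_poly B) a = 0" using that as(1) by (auto simp: poly_prod_list prod_list_zero_iff)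
    then obtain v where v: "v \<in> carrier_vec n" "v \<noteq> 0\<^sub>v n" "B *\<^sub>v v = a \<cdot>\<^sub>v v"
      using eigenvalue_root_char_poly[OF B] B by (auto simp: eigenvalue_def eigenvector_def)
    have Bv: "(\<Sum>j<n. ?c (A $$ (i, j)) * v $ j) = a * v $ i" if "i < n" for i
      using arg_cong[OF v(3), of "\<lambda>u. u $ i"] that v(1) A
      by (auto simp: B_def scalar_prod_def lessThan_atLeast0)
    have symA: "A $$ (i, j) = A $$ (j, i)" if "i < n" "j < n" for i j
      using arg_cong[OF sym, of "\<lambda>M. M $$ (j, i)"] that A by simp
    define S where "S = (\<Sum>i<n. \<Sum>j<n. cnj (v $ i) * ?c (A $$ (i, j)) * v $ j)"
    have "cnj S = (\<Sum>i<n. \<Sum>j<n. v $ i * ?c (A $$ (i, j)) * cnj (v $ j))"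
      by (simp add: S_def)
    also have "\<dots> = S" unfolding S_def
      by (subst sum.swap) (auto intro!: sum.cong simp: mult_ac symA)
    finally have "Im S = 0" by (metis Reals_cnj_iff complex_is_Real_iff)
    moreover have "S = (\<Sum>i<n. cnj (v $ i) * (\<Sum>j<n. ?c (A $$ (i, j)) * v $ j))"
      by (simp add: S_def sum_distrib_left mult_ac)
    then have "S = (\<Sum>i<n. cnj (v $ i) * (a * v $ i))"
      by (simp add: Bv)
    then have "S = a * ?c (\<Sum>i<n. (cmod (v $ i))\<^sup>2)"
      by (simp add: sum_distrib_left complex_norm_square mult_ac del: of_real_power)
    moreover have "(\<Sum>i<n. (cmod (v $ i))\<^sup>2) > 0"
    proof -
      obtain k where k: "k < n" "v $ k \<noteq> 0"
        using v(1,2) by (metis carrier_vecD eq_vecI index_zero_vec)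
      have "0 < (cmod (v $ k))\<^sup>2" using k by simp
      also have "\<dots> \<le> (\<Sum>i<n. (cmod (v $ i))\<^sup>2)" using k by (intro member_le_sum) auto
      finally show ?thesis .
    qed
    ultimately show ?thesis by (auto simp: complex_eq_iff)
  qed
  define es where "es = map Re as"
  have ases: "as = map ?c es"
    unfolding es_def using real by (auto simp: o_def complex_eq_iff intro!: map_idI[symmetric])
  have "map_poly ?c (char_poly A) = char_poly B" unfolding B_def by (rule of_real_hom.char_poly_hom[OF A, symmetric])
  also have "\<dots> = map_poly ?c (\<Prod>e\<leftarrow>es. [:- e, 1:])"
    unfolding as(1) ases c.hom_prod_list by (simp add: o_def)
  finally have "char_poly A = (\<Prod>e\<leftarrow>es. [:- e, 1:])" by simp
  with as(2) show ?thesis by (intro exI[of _ es]) (simp add: es_def)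
qed

text \<open>Half of the min-max principle: the span of the first \<open>s + 1\<close> eigenvectors
  and the space of vectors with \<open>s\<close> leading zeros have dimensions adding up to
  \<open>n + 1\<close>, so they share a unit vector, on which the form is at least
  \<open>d s\<close>.\<close>

lemma courant_fischer_upper:
  fixes B :: "real mat"
  assumes U: "ortho_mat n U" and B: "B \<in> carrier_mat n n" and D: "transpose_mat U * B * U = mat_diag n d"
    and s: "s < n" and d: "\<And>i. i \<le> s \<Longrightarrow> d s \<le> d i"
  shows "\<exists>v \<in> carrier_vec n. v \<bullet> v = 1 \<and> (\<forall>i<s. v $ i = 0) \<and> d s \<le> v \<bullet> (B *\<^sub>v v)"
proof -
  note U = ortho_matD[OF U]
  \<comment> \<open>Conditions on the coordinates \<open>c\<close> in the eigenbasis: rows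
    \<open>i < s\<close> of \<open>U\<close> make entry \<open>i\<close> of \<open>U c\<close>
    vanish, and the unit vectors remove the components beyond \<open>s\<close>. Together these are
    \<open>n - 1\<close> conditions.\<close>
  define f where "f = (\<lambda>i. if i < s then row U i else unit_vec n (Suc i))"
  have "\<exists>c \<in> carrier_vec n. c \<bullet> c = 1 \<and> (\<forall>i<n - 1. f i \<bullet> c = 0)"
    using s U(1) by (intro unit_vector_orthogonal) (auto simp: f_def)
  then obtain c where c: "c \<in> carrier_vec n" "c \<bullet> c = 1" "\<And>i. i < n - 1 \<Longrightarrow> f i \<bullet> c = 0" by blast
  have c0: "c $ i = 0" if "s < i" "i < n" for i
    using c(3)[of "i - 1"] c(1) that by (cases i) (auto simp: f_def)
  define v where "v = U *\<^sub>v c"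
  have v: "v \<in> carrier_vec n" unfolding v_def using U(1) c(1) by (rule mult_mat_vec_carrier)
  have Uv: "transpose_mat U *\<^sub>v v = c"
    unfolding v_def using U c(1) by (subst assoc_mult_mat_vec[symmetric, of _ n n _ n]) auto
  have "v \<bullet> v = (transpose_mat U *\<^sub>v v) \<bullet> c"
    unfolding v_def using U(1) c(1) by (intro transpose_vec_mult_scalar[symmetric, of _ n n]) auto
  then have vv: "v \<bullet> v = 1" using Uv c(2) by simp
  have "v \<bullet> (B *\<^sub>v v) = (B *\<^sub>v v) \<bullet> v" using B v by (intro comm_scalar_prod[of _ n]) auto
  also have "\<dots> = (transpose_mat U *\<^sub>v (B *\<^sub>v v)) \<bullet> c"
    using U(1) c(1) B v by (subst transpose_vec_mult_scalar[of _ n n]) (auto simp: v_def)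
  also have "transpose_mat U *\<^sub>v (B *\<^sub>v v) = (transpose_mat U * B) *\<^sub>v (U *\<^sub>v c)"
    unfolding v_def[symmetric] using U(1) B v by (intro assoc_mult_mat_vec[symmetric, of _ n n _ n]) auto
  also have "\<dots> = (transpose_mat U * B * U) *\<^sub>v c"
    using U(1) B c(1) by (intro assoc_mult_mat_vec[symmetric, of _ n n _ n]) auto
  also have "\<dots> = vec n (\<lambda>i. d i * c $ i)"
    unfolding D using c(1)
    by (intro eq_vecI) (auto simp: mat_diag_def scalar_prod_def if_distrib if_distribR sum.delta cong: if_cong)
  also have "\<dots> \<bullet> c = (\<Sum>i = 0..<n. d i * (c $ i)\<^sup>2)"
    using c(1) by (auto simp: scalar_prod_def power2_eq_square mult_ac)
  finally have eq: "v \<bullet> (B *\<^sub>v v) = (\<Sum>i = 0..<n. d i * (c $ i)\<^sup>2)" .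
  have "d s = (\<Sum>i = 0..<n. d s * (c $ i)\<^sup>2)"
    using c(1,2) by (simp add: scalar_prod_def power2_eq_square flip: sum_distrib_left)
  also have "\<dots> \<le> (\<Sum>i = 0..<n. d i * (c $ i)\<^sup>2)"
  proof (rule sum_mono)
    fix i assume "i \<in> {0..<n}"
    then show "d s * (c $ i)\<^sup>2 \<le> d i * (c $ i)\<^sup>2"
      using d[of i] c0[of i] by (cases "i \<le> s") (auto intro: mult_right_mono)
  qed
  finally have "d s \<le> v \<bullet> (B *\<^sub>v v)" using eq by simp
  moreover have "v $ i = 0" if "i < s" for i
    using c(3)[of i] that s U(1) by (auto simp: f_def v_def)
  ultimately show ?thesis using v vv by blast
qed

section \<open>Traces of powers and shifted determinants in terms of eigenvalues\<close>

lemma mat_diag_pow: "mat_diag n (d :: nat \<Rightarrow> real) ^\<^sub>m k = mat_diag n (\<lambda>i. d i ^ k)"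
proof (induction k)
  case 0
  show ?case by (auto simp: mat_diag_def intro!: eq_matI)
qed (simp add: mult.commute)

lemma sum_power_eigenvalues:
  assumes U: "ortho_mat n U" and A: "A \<in> carrier_mat n n" and D: "transpose_mat U * A * U = mat_diag n d"
  shows "(\<Sum>i<n. (A ^\<^sub>m k) $$ (i, i)) = (\<Sum>i<n. d i ^ k)"
proof -
  note U = ortho_matD[OF U]
  have "A = U * (transpose_mat U * A * U) * transpose_mat U"
  proof -
    have "U * (transpose_mat U * A * U) * transpose_mat U = (U * transpose_mat U) * A * (U * transpose_mat U)"
      using U(1) A by (auto simp: assoc_mult_mat[of _ n n _ n _ n])
    then show ?thesis using U A by auto
  qed
  then have "similar_mat_wit A (mat_diag n d) U (transpose_mat U)"
    unfolding D using U A by (intro similar_mat_witI[of _ _ n]) auto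
  then have "A ^\<^sub>m k = U * mat_diag n (\<lambda>i. d i ^ k) * transpose_mat U"
    using similar_mat_wit_pow_id mat_diag_pow by metis
  also have "U * mat_diag n (\<lambda>i. d i ^ k) = mat n n (\<lambda>(i, j). U $$ (i, j) * d j ^ k)"
    using U(1) by (rule mat_diag_mult_right)
  finally have eq: "A ^\<^sub>m k = mat n n (\<lambda>(i, j). U $$ (i, j) * d j ^ k) * transpose_mat U" .
  have Akii: "(A ^\<^sub>m k) $$ (i, i) = (\<Sum>j<n. U $$ (i, j) * U $$ (i, j) * d j ^ k)" if "i < n" for i
    unfolding eq using U(1) that by (simp add: scalar_prod_def mult_ac lessThan_atLeast0)
  have UU: "(\<Sum>i<n. U $$ (i, j) * U $$ (i, j)) = 1" if "j < n" for j
    using arg_cong[OF U(2), of "\<lambda>M. M $$ (j, j)"] U(1) that by (simp add: scalar_prod_def lessThan_atLeast0)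
  have "(\<Sum>i<n. (A ^\<^sub>m k) $$ (i, i)) = (\<Sum>j<n. (\<Sum>i<n. U $$ (i, j) * U $$ (i, j)) * d j ^ k)"
    unfolding sum_distrib_right by (subst sum.swap) (simp add: Akii)
  then show ?thesis by (simp add: UU)
qed

lemma det_upper_triangular_prod:
  assumes "upper_triangular A" "A \<in> carrier_mat n n"
  shows "det A = (\<Prod>i<n. A $$ (i, i))"
  using assms
  by (simp add: det_upper_triangular[OF assms] diag_mat_def interv_sum_list_conv_sum_set_nat
      prod.distinct_set_conv_list[symmetric] lessThan_atLeast0)

lemma det_mat_diag: "det (mat_diag n f) = (\<Prod>i<n. f i :: real)"
  by (subst det_upper_triangular_prod[of _ n]) (auto simp: mat_diag_def upper_triangular_def)

lemma det_shift_eigenvalues: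
  assumes U: "ortho_mat n U" and A: "A \<in> carrier_mat n n" and D: "transpose_mat U * A * U = mat_diag n d"
  shows "det (t \<cdot>\<^sub>m 1\<^sub>m n + A) = (\<Prod>i<n. t + d i)"
proof -
  note U = ortho_matD[OF U]
  let ?X = "t \<cdot>\<^sub>m 1\<^sub>m n + A"
  have "transpose_mat U * ?X * U = t \<cdot>\<^sub>m 1\<^sub>m n + mat_diag n d"
  proof -
    have "transpose_mat U * ?X = t \<cdot>\<^sub>m transpose_mat U + transpose_mat U * A"
      using U(1) A by (subst mult_add_distrib_mat[of _ n n]) auto
    also have "\<dots> * U = t \<cdot>\<^sub>m (transpose_mat U * U) + transpose_mat U * A * U"
      using U(1) A by (subst add_mult_distrib_mat[of _ n n]) auto
    finally show ?thesis by (simp add: U D)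
  qed
  also have "\<dots> = mat_diag n (\<lambda>i. t + d i)"
    by (intro eq_matI) (auto simp: mat_diag_def)
  finally have eq: "transpose_mat U * ?X * U = mat_diag n (\<lambda>i. t + d i)" .
  have "det (transpose_mat U) * det U = 1"
    using U(1,2) det_mult[of "transpose_mat U" n U] by simp
  then have "det ?X = det (transpose_mat U) * det ?X * det U" by (simp add: mult_ac)
  also have "\<dots> = det (transpose_mat U * ?X * U)"
    using U(1) A by (simp add: det_mult[of _ n])
  also have "\<dots> = (\<Prod>i<n. t + d i)" unfolding eq by (rule det_mat_diag)
  finally show ?thesis .
qed

section \<open>Asymptotic expansions\<close>

text \<open>The polynomial may change with the order \<open>m\<close> and no convergence is asked,
  so that the class is closed under order-by-order approximation. The filter \<open>at 0\<close> is
  deliberately two-sided.\<close>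

definition has_expansions :: "(real \<Rightarrow> real) \<Rightarrow> bool" where
  "has_expansions f \<longleftrightarrow> (\<forall>m. \<exists>p :: real poly. (\<lambda>e. f e - poly p e) \<in> O[at 0](\<lambda>e. e ^ m))"

lemma poly_bigo_1: "poly p \<in> O[at (0 :: real)](\<lambda>_. 1)"
  by (rule bigoI_tendsto[of _ _ "poly p 0"]) (auto intro!: isContD)

lemma power_bigo_power: "m \<le> k \<Longrightarrow> (\<lambda>e::real. e ^ k) \<in> O[at 0](\<lambda>e. e ^ m)"
proof -
  assume "m \<le> k"
  then obtain l where k: "k = m + l" using le_Suc_ex by blast
  have "(\<lambda>e::real. e ^ l) \<in> O[at 0](\<lambda>_. 1)"
    by (rule bigoI_tendsto[of _ _ "0 ^ l"]) (auto intro!: tendsto_intros)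
  then have "(\<lambda>e::real. e ^ m * e ^ l) \<in> O[at 0](\<lambda>e. e ^ m * 1)"
    by (intro landau_o.big.mult) auto
  then show ?thesis by (simp add: k power_add)
qed

text \<open>The one-sided limit of a polynomial at 0 is its value there; when it vanishes, a factor
  \<open>e\<close> splits off. A bound from the right suffices, as it must for eigenvalues given
  only for \<open>e > 0\<close>.\<close>

lemma poly_bigo_powerE:
  fixes p :: "real poly"
  assumes "poly p \<in> O[at_right 0](\<lambda>e. e ^ k)"
  obtains q where "p = monom 1 k * q"
proof -
  have "\<exists>q. p = monom 1 k * q" using assms
  proof (induction k arbitrary: p)
    case 0
    then show ?case by (intro exI[of _ p]) (simp add: monom_0)
  next
    case (Suc k)
    have "(\<lambda>e::real. e ^ Suc k) \<in> o[at_right 0](\<lambda>_. 1)"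
      by (rule smalloI_tendsto) (auto intro!: tendsto_eq_intros)
    with Suc.prems have "poly p \<in> o[at_right 0](\<lambda>_. 1)" by (rule landau_o.big_small_trans)
    then have "(poly p \<longlongrightarrow> 0) (at_right 0)" by (auto dest!: smalloD_tendsto)
    moreover have "(poly p \<longlongrightarrow> poly p 0) (at_right 0)"
      by (intro isContD[THEN tendsto_within_subset[of _ _ _ UNIV]]) auto
    ultimately have "poly p 0 = 0" using tendsto_unique trivial_limit_at_right_real by blast
    then obtain r where r: "p = [:0, 1:] * r" unfolding poly_eq_0_iff_dvd by (auto simp: dvd_def)
    have "(\<lambda>e. e * poly r e) \<in> O[at_right 0](\<lambda>e. e * e ^ k)" using Suc.prems by (simp add: r)
    then have "poly r \<in> O[at_right 0](\<lambda>e. e ^ k)"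
      by (subst (asm) landau_o.big.mult_cancel_left) (auto simp: eventually_at_filter)
    from Suc.IH[OF this] obtain q where "r = monom 1 k * q" by blast
    then have "p = monom 1 (Suc k) * q" by (simp add: r monom_Suc)
    then show ?case by blast
  qed
  then show ?thesis using that by blast
qed

lemma has_expansions_poly: "has_expansions (poly p)"
  unfolding has_expansions_def by (auto intro!: exI[of _ p])

lemma has_expansions_const: "has_expansions (\<lambda>_. c)"
  using has_expansions_poly[of "[:c:]"] by (subst (asm) ext[of "poly [:c:]" "\<lambda>_. c"]) auto

lemma has_expansions_add:
  assumes "has_expansions f" "has_expansions g"
  shows "has_expansions (\<lambda>e. f e + g e)"
  unfolding has_expansions_def
proof
  fix m
  obtain p q where "(\<lambda>e. f e - poly p e) \<in> O[at 0](\<lambda>e. e ^ m)" "(\<lambda>e. g e - poly q e) \<in> O[at 0](\<lambda>e. e ^ m)"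
    using assms unfolding has_expansions_def by blast
  from sum_in_bigo(1)[OF this] show "\<exists>p. (\<lambda>e. f e + g e - poly p e) \<in> O[at 0](\<lambda>e. e ^ m)"
    by (intro exI[of _ "p + q"]) (simp add: algebra_simps)
qed

lemma has_expansions_bigo_1:
  assumes "has_expansions f"
  shows "f \<in> O[at 0](\<lambda>_. 1)"
proof -
  obtain p where "(\<lambda>e. f e - poly p e) \<in> O[at 0](\<lambda>e. e ^ 0)"
    using assms unfolding has_expansions_def by blast
  then have "(\<lambda>e. f e - poly p e) \<in> O[at 0](\<lambda>_. 1)" by simp
  from sum_in_bigo(1)[OF this poly_bigo_1[of p]] show ?thesis by simp
qed

lemma has_expansions_mult:
  assumes "has_expansions f" "has_expansions g"
  shows "has_expansions (\<lambda>e. f e * g e)"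
  unfolding has_expansions_def
proof
  fix m
  obtain p q where pq: "(\<lambda>e. f e - poly p e) \<in> O[at 0](\<lambda>e. e ^ m)" "(\<lambda>e. g e - poly q e) \<in> O[at 0](\<lambda>e. e ^ m)"
    using assms unfolding has_expansions_def by blast
  have "(\<lambda>e. (f e - poly p e) * g e + poly p e * (g e - poly q e)) \<in> O[at 0](\<lambda>e. e ^ m)"
    using landau_o.big.mult[OF pq(1) has_expansions_bigo_1[OF assms(2)]]
      landau_o.big.mult[OF poly_bigo_1[of p] pq(2)]
    by (intro sum_in_bigo) simp_all
  then show "\<exists>p. (\<lambda>e. f e * g e - poly p e) \<in> O[at 0](\<lambda>e. e ^ m)"
    by (intro exI[of _ "p * q"]) (simp add: algebra_simps)
qed

lemma has_expansions_sum:
  assumes "\<And>i. i \<in> I \<Longrightarrow> has_expansions (f i)"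
  shows "has_expansions (\<lambda>e. \<Sum>i\<in>I. f i e)"
  using assms
  by (induction I rule: infinite_finite_induct) (auto intro!: has_expansions_const has_expansions_add)

text \<open>The approximant may depend on the order. This serves to replace a sharp cutoff by
  polynomial cutoffs that change with the order.\<close>

lemma has_expansions_approx:
  assumes "\<And>m. \<exists>g. has_expansions g \<and> (\<lambda>e. f e - g e) \<in> O[at 0](\<lambda>e. e ^ m)"
  shows "has_expansions f"
  unfolding has_expansions_def
proof
  fix m
  obtain g where g: "has_expansions g" "(\<lambda>e. f e - g e) \<in> O[at 0](\<lambda>e. e ^ m)" using assms by blast
  then obtain p where "(\<lambda>e. g e - poly p e) \<in> O[at 0](\<lambda>e. e ^ m)" unfolding has_expansions_def by blast
  from sum_in_bigo(1)[OF g(2) this] show "\<exists>p. (\<lambda>e. f e - poly p e) \<in> O[at 0](\<lambda>e. e ^ m)"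
    by (intro exI[of _ p]) simp
qed

lemma has_expansions_cong:
  assumes "has_expansions g" "\<forall>\<^sub>F e in at 0. f e = g e"
  shows "has_expansions f"
proof (rule has_expansions_approx)
  fix m
  have "(\<lambda>e. f e - g e) \<in> O[at 0](\<lambda>e. e ^ m)"
    using assms(2) by (intro bigoI[of _ 0]) (auto elim!: eventually_mono)
  with assms(1) show "\<exists>g. has_expansions g \<and> (\<lambda>e. f e - g e) \<in> O[at 0](\<lambda>e. e ^ m)" by blast
qed

lemma has_expansions_divide_power:
  assumes f: "has_expansions f" "f \<in> O[at 0](\<lambda>e. e ^ k)"
  shows "has_expansions (\<lambda>e. f e / e ^ k)"
  unfolding has_expansions_def
proof
  fix m
  \<comment> \<open>The \<open>k\<close> extra orders are consumed by the division by
    \<open>e ^ k\<close>.\<close>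
  obtain p where p: "(\<lambda>e. f e - poly p e) \<in> O[at 0](\<lambda>e. e ^ (k + m))"
    using f unfolding has_expansions_def by blast
  have "(\<lambda>e. f e - (f e - poly p e)) \<in> O[at 0](\<lambda>e. e ^ k)"
    by (rule sum_in_bigo(2)[OF f(2) landau_o.big_trans[OF p power_bigo_power]]) simp
  then have "poly p \<in> O[at 0](\<lambda>e. e ^ k)" by simp
  then have "poly p \<in> O[at_right 0](\<lambda>e. e ^ k)"
    by (rule landau_o.big.filter_mono[rotated]) (simp add: at_within_le_at)
  then obtain q where q: "p = monom 1 k * q" by (rule poly_bigo_powerE)
  have "\<forall>\<^sub>F e::real in at 0. e \<noteq> 0" by (rule eventually_neq_at_within)
  then have "\<forall>\<^sub>F e::real in at 0. e ^ k \<noteq> 0" by eventually_elim simp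
  then have "(\<lambda>e. (f e - poly p e) / e ^ k) \<in> O[at 0](\<lambda>e. e ^ (k + m) / e ^ k)"
    using p by (intro landau_o.big.divide_right)
  also have "(\<lambda>e::real. e ^ (k + m) / e ^ k) \<in> O[at 0](\<lambda>e. e ^ m)"
    by (rule bigoI[of _ 1]) (auto simp: eventually_at_filter power_add)
  finally have "(\<lambda>e. (f e - poly p e) / e ^ k) \<in> O[at 0](\<lambda>e. e ^ m)" .
  also have "?this \<longleftrightarrow> (\<lambda>e. f e / e ^ k - poly q e) \<in> O[at 0](\<lambda>e. e ^ m)"
    by (intro landau_o.big.in_cong) (auto simp: eventually_at_filter q poly_monom field_simps)
  finally show "\<exists>p. (\<lambda>e. f e / e ^ k - poly p e) \<in> O[at 0](\<lambda>e. e ^ m)" by blast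
qed

lemma has_expansions_limit:
  assumes "has_expansions f"
  obtains l where "(f \<longlongrightarrow> l) (at 0)" "(\<lambda>e. f e - l) \<in> O[at 0](\<lambda>e. e)"
proof -
  obtain p where p: "(\<lambda>e. f e - poly p e) \<in> O[at 0](\<lambda>e. e ^ 1)"
    using assms unfolding has_expansions_def by blast
  have "poly (p - [:poly p 0:]) 0 = 0" by simp
  then obtain r where r: "p - [:poly p 0:] = [:0, 1:] * r"
    unfolding poly_eq_0_iff_dvd by (auto simp: dvd_def)
  have "poly p e - poly p 0 = e * poly r e" for e using arg_cong[OF r, of "\<lambda>p. poly p e"] by simp
  then have "(\<lambda>e. poly p e - poly p 0) \<in> O[at 0](\<lambda>e. e)"
    using landau_o.big.mult[OF landau_o.big_refl poly_bigo_1[of r], of "\<lambda>e. e"] by simp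
  from sum_in_bigo(1)[OF p[simplified] this]
  have O: "(\<lambda>e. f e - poly p 0) \<in> O[at 0](\<lambda>e. e)" by simp
  also have "(\<lambda>e::real. e) \<in> o[at 0](\<lambda>_. 1)" by (rule smalloI_tendsto) (auto intro!: tendsto_eq_intros)
  finally have "((\<lambda>e. f e - poly p 0) \<longlongrightarrow> 0) (at 0)" by (auto dest!: smalloD_tendsto)
  then have "(f \<longlongrightarrow> poly p 0) (at 0)" by (simp add: LIM_zero_iff)
  with O show ?thesis using that by blast
qed

text \<open>This is the only place where both signs of \<open>e\<close> matter: a nonnegative function cannot have
  a nonzero linear leading term.\<close>

lemma has_expansions_nonneg_bigo_square:
  assumes f: "has_expansions f" and nonneg: "\<forall>\<^sub>F e in at 0. f e \<ge> 0" and O: "f \<in> O[at 0](\<lambda>e. e)"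
  shows "f \<in> O[at 0](\<lambda>e. e ^ 2)"
proof -
  have "has_expansions (\<lambda>e. f e / e ^ 1)" using f O by (intro has_expansions_divide_power) auto
  then obtain l where l: "((\<lambda>e. f e / e) \<longlongrightarrow> l) (at 0)" "(\<lambda>e. f e / e - l) \<in> O[at 0](\<lambda>e. e)"
    by (auto elim: has_expansions_limit)
  have ev: "\<forall>\<^sub>F e in at_right 0. f e \<ge> 0" "\<forall>\<^sub>F e in at_left 0. f e \<ge> 0"
    using nonneg by (auto simp: eventually_at_split)
  have "l \<ge> 0"
  proof (rule tendsto_lowerbound)
    show "((\<lambda>e. f e / e) \<longlongrightarrow> l) (at_right 0)" using l(1) by (simp add: filterlim_at_split)
    show "\<forall>\<^sub>F e in at_right 0. f e / e \<ge> 0"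
      using ev(1) eventually_at_right_less[of 0] by eventually_elim auto
  qed auto
  moreover have "l \<le> 0"
  proof (rule tendsto_upperbound)
    show "((\<lambda>e. f e / e) \<longlongrightarrow> l) (at_left 0)" using l(1) by (simp add: filterlim_at_split)
    have "\<forall>\<^sub>F e in at_left (0::real). e < 0" by (auto simp: eventually_at_filter)
    then show "\<forall>\<^sub>F e in at_left 0. f e / e \<le> 0"
      using ev(2) by eventually_elim (auto simp: divide_nonneg_neg)
  qed auto
  ultimately have "(\<lambda>e. f e / e) \<in> O[at 0](\<lambda>e. e)" using l(2) by simp
  from landau_o.big.mult[OF this landau_o.big_refl, of "\<lambda>e. e"]
  have "(\<lambda>e. f e / e * e) \<in> O[at 0](\<lambda>e. e ^ 2)" by (simp add: power2_eq_square)
  also have "?this \<longleftrightarrow> f \<in> O[at 0](\<lambda>e. e ^ 2)"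
    by (intro landau_o.big.in_cong) (auto simp: eventually_at_filter)
  finally show ?thesis .
qed

text \<open>The tail from index \<open>m\<close> on is \<open>e ^ m\<close> times a power series
  that is continuous at 0, hence bounded near 0.\<close>

lemma real_analytic_has_expansions:
  assumes f: "\<And>e. \<bar>e\<bar> < r \<Longrightarrow> (\<lambda>k. c k * e ^ k) sums f e" and "r > 0"
  shows "has_expansions f"
  unfolding has_expansions_def
proof
  fix m
  define g where "g = (\<lambda>e. \<Sum>k. c (k + m) * e ^ k)"
  have sg: "summable (\<lambda>k. c (k + m) * e ^ k)" if "\<bar>e\<bar> < r" for e
  proof (cases "e = 0")
    case True
    then show ?thesis by (simp add: summable_0_powser)
  next
    case False
    have "summable (\<lambda>k. c (k + m) * e ^ (k + m))"
      using f[OF that] sums_summable by (subst summable_iff_shift) blast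
    then have "summable (\<lambda>k. inverse (e ^ m) * (c (k + m) * e ^ (k + m)))" by (rule summable_mult)
    also have "(\<lambda>k. inverse (e ^ m) * (c (k + m) * e ^ (k + m))) = (\<lambda>k. c (k + m) * e ^ k)"
      using False by (auto simp: power_add field_simps)
    finally show ?thesis .
  qed
  have eq: "f e - (\<Sum>k<m. c k * e ^ k) = e ^ m * g e" if "\<bar>e\<bar> < r" for e
  proof -
    have "(\<lambda>k. c (k + m) * e ^ (k + m)) sums (f e - (\<Sum>k<m. c k * e ^ k))"
      using f[OF that] by (subst sums_iff_shift) simp
    moreover have "(\<lambda>k. e ^ m * (c (k + m) * e ^ k)) sums (e ^ m * g e)"
      unfolding g_def using sg[OF that] by (intro sums_mult summable_sums)
    then have "(\<lambda>k. c (k + m) * e ^ (k + m)) sums (e ^ m * g e)" by (simp add: power_add mult_ac)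
    ultimately show ?thesis by (rule sums_unique2)
  qed
  have "isCont g 0" unfolding g_def
    using sg[of "r / 2"] \<open>r > 0\<close> by (intro isCont_powser[of _ "r / 2"]) auto
  then have "g \<in> O[at 0](\<lambda>_. 1)"
    by (intro bigoI_tendsto[of _ _ "g 0"]) (auto simp: isCont_def)
  from landau_o.big.mult[OF landau_o.big_refl this, of "\<lambda>e. e ^ m"]
  have "(\<lambda>e. e ^ m * g e) \<in> O[at 0](\<lambda>e. e ^ m)" by simp
  also have "?this \<longleftrightarrow> (\<lambda>e. f e - poly (\<Sum>k<m. monom (c k) k) e) \<in> O[at 0](\<lambda>e. e ^ m)"
  proof (intro landau_o.big.in_cong)
    have "\<forall>\<^sub>F e in at 0. \<bar>e\<bar> < r" using \<open>r > 0\<close> by (auto simp: eventually_at dist_real_def)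
    then show "\<forall>\<^sub>F e in at 0. e ^ m * g e = f e - poly (\<Sum>k<m. monom (c k) k) e"
      by eventually_elim (simp add: eq[symmetric] poly_sum poly_monom)
  qed
  finally show "\<exists>p. (\<lambda>e. f e - poly p e) \<in> O[at 0](\<lambda>e. e ^ m)" by blast
qed

text \<open>If \<open>g\<close> interpolates the indicator of \<open>\<mu>\<close> on \<open>S\<close>, then \<open>1 - (1 - g ^ N) ^ N\<close> does so to order \<open>N\<close>.\<close>

lemma poly_indicator_high_order:
  fixes S :: "real set"
  assumes S: "finite S" "\<mu> \<in> S"
  shows "\<exists>h. [:- \<mu>, 1:] ^ N dvd 1 - h \<and> (\<forall>\<nu>\<in>S - {\<mu>}. [:- \<nu>, 1:] ^ N dvd h)"
proof -
  define g where "g = (\<Prod>\<nu>\<in>S - {\<mu>}. Polynomial.smult (1 / (\<mu> - \<nu>)) [:- \<nu>, 1:])"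
  define h where "h = 1 - (1 - g ^ N) ^ N"
  have "poly g \<mu> = 1" unfolding g_def poly_prod by (intro prod.neutral) (auto simp flip: diff_divide_distrib)
  then have "poly (1 - g ^ N) \<mu> = 0" by simp
  then have "[:- \<mu>, 1:] dvd 1 - g ^ N" by (simp only: poly_eq_0_iff_dvd)
  then have "[:- \<mu>, 1:] ^ N dvd 1 - h" by (simp add: h_def dvd_power_same)
  moreover have "[:- \<nu>, 1:] ^ N dvd h" if "\<nu> \<in> S - {\<mu>}" for \<nu>
  proof -
    have "Polynomial.smult (1 / (\<mu> - \<nu>)) [:- \<nu>, 1:] dvd g" unfolding g_def using S that by (intro dvd_prodI) auto
    then have "[:- \<nu>, 1:] dvd g" using that by (subst (asm) smult_dvd_iff) auto
    then have "[:- \<nu>, 1:] ^ N dvd g ^ N" by (rule dvd_power_same)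
    \<comment> \<open>\<open>1 - u ^ N\<close> is divisible by \<open>1 - u\<close>; here
      \<open>u = 1 - g ^ N\<close>.\<close>
    also have "g ^ N dvd 1 ^ N - (1 - g ^ N) ^ N"
      using dvd_triv_left[of "1 - (1 - g ^ N)" "\<Sum>i<N. (1 - g ^ N) ^ (N - Suc i) * 1 ^ i"]
      by (subst power_diff_sumr2) simp
    finally show ?thesis by (simp add: h_def)
  qed
  ultimately show ?thesis by blast
qed

section \<open>Elementary bounds, common subsequences and matchings of multisets\<close>

lemma poly_bounded_ball:
  fixes p :: "real poly"
  shows "\<exists>C. \<forall>z. \<bar>z\<bar> \<le> R \<longrightarrow> \<bar>poly p z\<bar> \<le> C"
proof -
  have "compact (poly p ` {-R..R})"
    by (intro compact_continuous_image continuous_intros) auto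
  then obtain C where "\<forall>y\<in>poly p ` {-R..R}. norm y \<le> C" using compact_imp_bounded bounded_iff by metis
  then show ?thesis by (intro exI[of _ C]) (auto simp: abs_le_iff)
qed

lemma dvd_poly_bound:
  fixes p :: "real poly"
  assumes "[:- \<mu>, 1:] ^ N dvd p"
  shows "\<exists>C. \<forall>z. \<bar>z\<bar> \<le> R \<longrightarrow> \<bar>poly p z\<bar> \<le> C * \<bar>z - \<mu>\<bar> ^ N"
proof -
  from assms obtain q where q: "p = [:- \<mu>, 1:] ^ N * q" by (auto simp: dvd_def)
  obtain C where C: "\<And>z. \<bar>z\<bar> \<le> R \<Longrightarrow> \<bar>poly q z\<bar> \<le> C" using poly_bounded_ball by blast
  have "\<bar>poly p z\<bar> \<le> C * \<bar>z - \<mu>\<bar> ^ N" if "\<bar>z\<bar> \<le> R" for z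
  proof -
    have "\<bar>poly p z\<bar> = \<bar>z - \<mu>\<bar> ^ N * \<bar>poly q z\<bar>" by (simp add: q abs_mult power_abs)
    also have "\<dots> \<le> \<bar>z - \<mu>\<bar> ^ N * C" using C[OF that] by (intro mult_left_mono) auto
    finally show ?thesis by (simp add: mult_ac)
  qed
  then show ?thesis by blast
qed

lemma bounded_sequences_common_subsequence:
  fixes f :: "nat \<Rightarrow> nat \<Rightarrow> real"
  assumes "\<And>i k. i < n \<Longrightarrow> \<bar>f i k\<bar> \<le> C"
  shows "\<exists>r l. strict_mono r \<and> (\<forall>i<n. (\<lambda>k. f i (r k)) \<longlonglongrightarrow> l i)"
  using assms
proof (induction n)
  case 0
  show ?case by (auto intro!: exI[of _ id] strict_mono_id)
next
  case (Suc n)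
  then obtain r l where r: "strict_mono r" "\<And>i. i < n \<Longrightarrow> (\<lambda>k. f i (r k)) \<longlonglongrightarrow> l i" by (metis less_SucI)
  have "bounded (range (\<lambda>k. f n (r k)))" using Suc.prems by (auto simp: bounded_iff)
  then obtain l' r' where r': "strict_mono r'" "((\<lambda>k. f n (r k)) \<circ> r') \<longlonglongrightarrow> l'"
    using bounded_imp_convergent_subsequence by blast
  show ?case
  proof (intro exI conjI allI impI)
    show "strict_mono (r \<circ> r')" using r(1) r'(1) by (rule strict_mono_o)
    fix i assume "i < Suc n"
    then show "(\<lambda>k. f i ((r \<circ> r') k)) \<longlonglongrightarrow> (l(n := l')) i"
      using r(2)[THEN LIMSEQ_subseq_LIMSEQ[OF _ r'(1)], of i] r'(2) by (cases "i = n") (auto simp: o_def)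
  qed
qed

lemma finite_set_separated:
  fixes S :: "real set"
  assumes "finite S"
  obtains g where "g > 0" "\<And>\<mu> \<nu>. \<mu> \<in> S \<Longrightarrow> \<nu> \<in> S \<Longrightarrow> \<mu> \<noteq> \<nu> \<Longrightarrow> 2 * g \<le> \<bar>\<mu> - \<nu>\<bar>"
proof -
  \<comment> \<open>The extra element 1 keeps \<open>M\<close> nonempty when \<open>S\<close> has
    fewer than two points.\<close>
  define M where "M = insert 1 ((\<lambda>(\<mu>, \<nu>). \<bar>\<mu> - \<nu>\<bar>) ` {(\<mu>, \<nu>) \<in> S \<times> S. \<mu> \<noteq> \<nu>})"
  have M: "finite M" unfolding M_def using assms by (intro finite.insertI finite_imageI finite_subset[OF _ finite_cartesian_product[of S S]]) auto
  have "Min M > 0" using M by (subst Min_gr_iff) (auto simp: M_def)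
  moreover have "Min M \<le> \<bar>\<mu> - \<nu>\<bar>" if "\<mu> \<in> S" "\<nu> \<in> S" "\<mu> \<noteq> \<nu>" for \<mu> \<nu>
    using M that by (intro Min_le) (auto simp: M_def)
  ultimately show ?thesis by (intro that[of "Min M / 2"]) auto
qed

lemma rel_mset_union:
  assumes "rel_mset R A B" "rel_mset R C D"
  shows "rel_mset R (A + C) (B + D)"
proof -
  obtain as bs cs ds where "mset as = A" "mset bs = B" "list_all2 R as bs"
    "mset cs = C" "mset ds = D" "list_all2 R cs ds"
    using assms unfolding rel_mset_def by metis
  then show ?thesis
    unfolding rel_mset_def by (intro exI[of _ "as @ cs"] exI[of _ "bs @ ds"]) (auto intro: list_all2_appendI)
qed

lemma rel_mset_sum:
  assumes "\<And>i. i \<in> S \<Longrightarrow> rel_mset R (A i) (B i)"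
  shows "rel_mset R (\<Sum>i\<in>S. A i) (\<Sum>i\<in>S. B i)"
  using assms
  by (induction S rule: infinite_finite_induct) (auto intro!: rel_mset_Zero rel_mset_union)

section \<open>Multisets whose power sums have expansions\<close>

lemma has_expansions_sum_mset_poly:
  assumes "\<And>k. has_expansions (\<lambda>e. \<Sum>z\<in>#L e. z ^ k)"
  shows "has_expansions (\<lambda>e. \<Sum>z\<in>#L e. poly p z)"
proof -
  have "has_expansions (\<lambda>e. \<Sum>z\<in>#L e. z ^ k * poly p z)" for k
  proof (induction p arbitrary: k)
    case 0
    show ?case by (simp add: has_expansions_const)
  next
    case (pCons a p)
    have "has_expansions (\<lambda>e. a * (\<Sum>z\<in>#L e. z ^ k) + (\<Sum>z\<in>#L e. z ^ Suc k * poly p z))"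
      by (intro has_expansions_add has_expansions_mult has_expansions_const assms pCons.IH)
    then show ?case
      by (simp add: algebra_simps sum_mset.distrib flip: sum_mset_distrib_left)
  qed
  from this[of 0] show ?thesis by simp
qed

lemma sum_mset_abs_bound:
  fixes f :: "'a \<Rightarrow> real"
  assumes "\<And>z. z \<in># A \<Longrightarrow> \<bar>f z\<bar> \<le> c"
  shows "\<bar>\<Sum>z\<in>#A. f z\<bar> \<le> real (size A) * c"
  using assms
proof (induction A)
  case (add x A)
  have "\<bar>\<Sum>z\<in>#A. f z\<bar> \<le> real (size A) * c" using add by auto
  moreover have "\<bar>f x\<bar> \<le> c" using add.prems by auto
  ultimately show ?case by (auto simp: algebra_simps)
qed auto

lemma sum_mset_filter:
  "(\<Sum>z\<in>#filter_mset P A. f z) = (\<Sum>z\<in>#A. if P z then f z else (0 :: real))"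
  by (induction A) auto

lemma sum_mset_subtract:
  fixes f g :: "'a \<Rightarrow> real"
  shows "(\<Sum>z\<in>#A. f z - g z) = (\<Sum>z\<in>#A. f z) - (\<Sum>z\<in>#A. g z)"
  by (induction A) auto

lemma sum_mset_nonneg:
  fixes f :: "'a \<Rightarrow> real"
  shows "(\<And>z. f z \<ge> 0) \<Longrightarrow> (\<Sum>z\<in>#A. f z) \<ge> 0"
  by (induction A) auto

lemma sum_mset_member_le:
  fixes f :: "'a \<Rightarrow> real"
  assumes "\<And>z. f z \<ge> 0" "x \<in># A"
  shows "f x \<le> (\<Sum>z\<in>#A. f z)"
proof -
  obtain B where "A = add_mset x B" using assms(2) by (rule mset_add)
  moreover have "(\<Sum>z\<in>#B. f z) \<ge> 0" using assms(1) by (intro sum_mset_nonneg) auto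
  ultimately show ?thesis by simp
qed

lemma rel_mset_replicate: "(\<And>z. z \<in># A \<Longrightarrow> R z b) \<Longrightarrow> rel_mset R A (replicate_mset (size A) b)"
  by (induction A) (auto intro: rel_mset_Zero rel_mset_Plus)

text \<open>The points are real, so each square is at most the second power sum, which stays bounded
  near 0.\<close>

lemma power_sums_bounded:
  assumes "\<And>k. has_expansions (\<lambda>e. \<Sum>z\<in>#L e. z ^ k)"
  shows "\<exists>R. \<forall>\<^sub>F e in at 0. \<forall>z\<in>#L e. \<bar>z\<bar> \<le> R"
proof -
  from has_expansions_bigo_1[OF assms[of 2]] obtain C where
    "\<forall>\<^sub>F e in at 0. norm (\<Sum>z\<in>#L e. z\<^sup>2) \<le> C * norm (1::real)" by (rule landau_o.bigE)
  then have "\<forall>\<^sub>F e in at 0. \<forall>z\<in>#L e. \<bar>z\<bar> \<le> 1 + C"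
  proof eventually_elim
    case (elim e)
    show ?case
    proof
      fix z assume "z \<in># L e"
      then have "z\<^sup>2 \<le> (\<Sum>z\<in>#L e. z\<^sup>2)" by (intro sum_mset_member_le) auto
      with elim have "\<bar>z\<bar>\<^sup>2 \<le> C" by simp
      moreover have "2 * \<bar>z\<bar> \<le> 1 + \<bar>z\<bar>\<^sup>2" using zero_le_power2[of "\<bar>z\<bar> - 1"] by (simp add: power2_eq_square algebra_simps)
      ultimately show "\<bar>z\<bar> \<le> 1 + C" by linarith
    qed
  qed
  then show ?thesis by blast
qed

text \<open>Limits along one sequence suffice. Let \<open>S\<close> be the set of these limits and
  \<open>\<psi>\<close> the monic polynomial having them as simple roots. The sum of
  \<open>\<psi> ^ 2\<close> over the points has a limit, which the sequence shows to be 0;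
  nonnegativity improves this to \<open>O(e ^ 2)\<close>, so \<open>\<psi>\<close> is
  \<open>O(e)\<close> at every point. Only the factor of the nearest root can be small.\<close>

lemma power_sums_cluster_points:
  assumes size: "\<forall>\<^sub>F e in at 0. size (L e) = n"
    and ps: "\<And>k. has_expansions (\<lambda>e. \<Sum>z\<in>#L e. z ^ k)"
  shows "\<exists>S C. finite S \<and> (\<forall>\<^sub>F e in at 0. \<forall>z\<in>#L e. \<exists>\<mu>\<in>S. \<bar>z - \<mu>\<bar> \<le> C * \<bar>e\<bar>)"
proof -
  obtain R where "\<forall>\<^sub>F e in at 0. \<forall>z\<in>#L e. \<bar>z\<bar> \<le> R" using power_sums_bounded[OF ps] by blast
  with size have "\<forall>\<^sub>F e in at 0. size (L e) = n \<and> (\<forall>z\<in>#L e. \<bar>z\<bar> \<le> R)" by eventually_elim auto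
  then obtain \<delta> where \<delta>: "\<delta> > 0" "\<And>e. e \<noteq> 0 \<Longrightarrow> \<bar>e\<bar> < \<delta> \<Longrightarrow> size (L e) = n \<and> (\<forall>z\<in>#L e. \<bar>z\<bar> \<le> R)"
    unfolding eventually_at by (auto simp: dist_real_def)
  \<comment> \<open>The offset 2 makes \<open>t k < \<delta>\<close> strict already for
    \<open>k = 0\<close>.\<close>
  define t where "t = (\<lambda>k::nat. \<delta> / real (k + 2))"
  have t: "t k \<noteq> 0" "\<bar>t k\<bar> < \<delta>" for k
    using \<delta>(1) mult_nonneg_nonneg[of \<delta> "real k"] by (auto simp: t_def field_simps intro: add_pos_nonneg)
  have t0: "t \<longlonglongrightarrow> 0" unfolding t_def by real_asymp
  define xs where "xs = (\<lambda>k. SOME xs. mset xs = L (t k))"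
  have xs: "mset (xs k) = L (t k)" for k unfolding xs_def by (rule someI_ex) (rule ex_mset)
  have len: "length (xs k) = n" for k using \<delta>(2)[OF t] xs[of k] by (metis size_mset)
  have "\<bar>xs k ! i\<bar> \<le> R" if "i < n" for i k
    using \<delta>(2)[OF t, of k] that len[of k] by (auto simp flip: xs)
  then obtain r l where r: "strict_mono r" "\<And>i. i < n \<Longrightarrow> (\<lambda>k. xs (r k) ! i) \<longlonglongrightarrow> l i"
    using bounded_sequences_common_subsequence[of n "\<lambda>i k. xs k ! i" R] by auto
  define S where "S = l ` {..<n}"
  have S: "finite S" by (simp add: S_def)
  define \<psi> where "\<psi> = (\<Prod>\<mu>\<in>S. [:- \<mu>, 1:])"
  define F where "F = (\<lambda>e. \<Sum>z\<in>#L e. poly (\<psi> ^ 2) z)"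
  have F: "has_expansions F" unfolding F_def by (intro has_expansions_sum_mset_poly ps)
  obtain c where c: "(F \<longlongrightarrow> c) (at 0)" "(\<lambda>e. F e - c) \<in> O[at 0](\<lambda>e. e)"
    using has_expansions_limit[OF F] by blast
  have "filterlim (t \<circ> r) (at 0) sequentially"
    using LIMSEQ_subseq_LIMSEQ[OF t0 r(1)] t by (intro filterlim_atI) auto
  from filterlim_compose[OF c(1) this] have "(\<lambda>k. F (t (r k))) \<longlonglongrightarrow> c" by (simp add: o_def)
  moreover have "(\<lambda>k. F (t (r k))) \<longlonglongrightarrow> (\<Sum>i<n. poly (\<psi> ^ 2) (l i))"
  proof -
    have "F (t (r k)) = (\<Sum>i<n. poly (\<psi> ^ 2) (xs (r k) ! i))" for k
      unfolding F_def xs[symmetric] using len[of "r k"]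
      by (simp flip: mset_map add: sum_mset_sum_list sum_list_sum_nth lessThan_atLeast0)
    then show ?thesis using r(2) by (auto intro!: tendsto_intros)
  qed
  moreover have "poly \<psi> (l i) = 0" if "i < n" for i
    using that S by (auto simp: \<psi>_def poly_prod S_def)
  ultimately have "c = 0" using LIMSEQ_unique by fastforce
  with c F have "F \<in> O[at 0](\<lambda>e. e ^ 2)"
    by (intro has_expansions_nonneg_bigo_square) (auto simp: F_def intro!: always_eventually sum_mset_nonneg)
  then obtain D where D: "\<forall>\<^sub>F e in at 0. norm (F e) \<le> D * norm (e ^ 2)" by (rule landau_o.bigE)
  obtain g where g: "g > 0" "\<And>\<mu> \<nu>. \<mu> \<in> S \<Longrightarrow> \<nu> \<in> S \<Longrightarrow> \<mu> \<noteq> \<nu> \<Longrightarrow> 2 * g \<le> \<bar>\<mu> - \<nu>\<bar>"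
    using finite_set_separated[OF S] by blast
  \<comment> \<open>The numerator bounds the values of \<open>\<psi>\<close> relative to
    \<open>\<bar>e\<bar>\<close>; each of the \<open>card S - 1\<close> factors other than that of
    the nearest root is at least \<open>g\<close>.\<close>
  define C where "C = sqrt (max D 0) / g ^ (card S - 1)"
  have "\<forall>\<^sub>F e in at 0. \<forall>z\<in>#L e. \<exists>\<mu>\<in>S. \<bar>z - \<mu>\<bar> \<le> C * \<bar>e\<bar>"
    using D size
  proof eventually_elim
    case (elim e)
    show ?case
    proof
      fix z assume z: "z \<in># L e"
      then have "n \<noteq> 0" using elim(2) by (auto simp flip: nonempty_has_size)
      then have "S \<noteq> {}" by (auto simp: S_def)
      then obtain \<mu> where \<mu>: "\<mu> \<in> S" "\<And>\<nu>. \<nu> \<in> S \<Longrightarrow> \<bar>z - \<mu>\<bar> \<le> \<bar>z - \<nu>\<bar>"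
        using arg_min_if_finite[OF S, of "\<lambda>\<nu>. \<bar>z - \<nu>\<bar>"] by (metis linorder_not_le)
      have "poly (\<psi>\<^sup>2) z \<le> F e"
        unfolding F_def by (rule sum_mset_member_le[OF _ z]) simp
      then have "(poly \<psi> z)\<^sup>2 \<le> F e" by simp
      also have "\<dots> \<le> D * e\<^sup>2" using elim(1) by auto
      also have "\<dots> \<le> max D 0 * e\<^sup>2" by (intro mult_right_mono) auto
      finally have "sqrt ((poly \<psi> z)\<^sup>2) \<le> sqrt (max D 0 * e\<^sup>2)" by (rule real_sqrt_le_mono)
      then have \<psi>z: "\<bar>poly \<psi> z\<bar> \<le> sqrt (max D 0) * \<bar>e\<bar>" by (simp add: real_sqrt_mult)
      have "\<bar>z - \<mu>\<bar> * g ^ (card S - 1) = \<bar>z - \<mu>\<bar> * (\<Prod>\<nu>\<in>S - {\<mu>}. g)" using \<mu>(1) S by simp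
      also have "\<dots> \<le> \<bar>z - \<mu>\<bar> * (\<Prod>\<nu>\<in>S - {\<mu>}. \<bar>z - \<nu>\<bar>)"
      proof (intro mult_left_mono prod_mono conjI)
        fix \<nu> assume "\<nu> \<in> S - {\<mu>}"
        then show "g \<le> \<bar>z - \<nu>\<bar>" using g(2)[of \<mu> \<nu>] \<mu> by force
      qed (use g in auto)
      also have "\<dots> = \<bar>\<Prod>\<nu>\<in>S. z - \<nu>\<bar>"
        using \<mu>(1) S by (simp only: prod.remove[of S \<mu>] abs_mult abs_prod)
      also have "(\<Prod>\<nu>\<in>S. z - \<nu>) = poly \<psi> z" by (simp add: \<psi>_def poly_prod)
      finally have "\<bar>z - \<mu>\<bar> * g ^ (card S - 1) \<le> sqrt (max D 0) * \<bar>e\<bar>" using \<psi>z by simp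
      then have "\<bar>z - \<mu>\<bar> \<le> C * \<bar>e\<bar>" using g(1) by (simp add: C_def field_simps)
      with \<mu>(1) show "\<exists>\<mu>\<in>S. \<bar>z - \<mu>\<bar> \<le> C * \<bar>e\<bar>" by blast
    qed
  qed
  with S show ?thesis by blast
qed

text \<open>Replacing the cutoff to the cluster at \<open>\<mu>\<close> by the polynomial indicator of order \<open>N\<close> costs only
  \<open>O(e ^ N)\<close>.\<close>

lemma cluster_power_sums:
  fixes L :: "real \<Rightarrow> real multiset"
  assumes ps: "\<And>k. has_expansions (\<lambda>e. \<Sum>z\<in>#L e. z ^ k)"
    and size: "\<forall>\<^sub>F e in at 0. size (L e) = n"
    and S: "finite S" "\<mu> \<in> S"
    and near: "\<forall>\<^sub>F e in at 0. \<forall>z\<in>#L e. \<exists>\<nu>\<in>S. \<bar>z - \<nu>\<bar> \<le> C * \<bar>e\<bar> \<and> (\<bar>z - \<mu>\<bar> < g \<longleftrightarrow> \<nu> = \<mu>)"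
  shows "has_expansions (\<lambda>e. \<Sum>z\<in>#filter_mset (\<lambda>z. \<bar>z - \<mu>\<bar> < g) (L e). (z - \<mu>) ^ k)"
proof (rule has_expansions_approx)
  fix N
  obtain h where h: "[:- \<mu>, 1:] ^ N dvd 1 - h" "\<And>\<nu>. \<nu> \<in> S - {\<mu>} \<Longrightarrow> [:- \<nu>, 1:] ^ N dvd h"
    using poly_indicator_high_order[OF S] by blast
  \<comment> \<open>At \<open>\<mu>\<close> the difference of \<open>p\<close> and
    \<open>(z - \<mu>) ^ k\<close> vanishes to order \<open>N\<close>, at the other points of
    \<open>S\<close> the polynomial \<open>p\<close> itself does. As every \<open>z\<close> is
    within \<open>O(e)\<close> of \<open>S\<close>, each term errs by
    \<open>O(e ^ N)\<close>.\<close>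
  define p where "p = h * [:- \<mu>, 1:] ^ k"
  obtain R where R: "\<forall>\<^sub>F e in at 0. \<forall>z\<in>#L e. \<bar>z\<bar> \<le> R" using power_sums_bounded[OF ps] by blast
  have "\<exists>D. \<forall>z. \<bar>z\<bar> \<le> R \<longrightarrow> \<bar>poly p z - (if \<nu> = \<mu> then (z - \<mu>) ^ k else 0)\<bar> \<le> D * \<bar>z - \<nu>\<bar> ^ N" if "\<nu> \<in> S" for \<nu>
  proof (cases "\<nu> = \<mu>")
    case True
    have "[:- \<nu>, 1:] ^ N dvd (1 - h) * [:- \<mu>, 1:] ^ k" using h(1) True by auto
    from dvd_poly_bound[OF this, of R] obtain D where
      D: "\<And>z. \<bar>z\<bar> \<le> R \<Longrightarrow> \<bar>poly ((1 - h) * [:- \<mu>, 1:] ^ k) z\<bar> \<le> D * \<bar>z - \<nu>\<bar> ^ N" by blast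
    have "poly p z - (z - \<mu>) ^ k = - poly ((1 - h) * [:- \<mu>, 1:] ^ k) z" for z
      by (simp add: p_def algebra_simps)
    with D True show ?thesis by auto
  next
    case False
    then have "[:- \<nu>, 1:] ^ N dvd p" using h(2)[of \<nu>] that by (auto simp: p_def)
    from dvd_poly_bound[OF this, of R] False show ?thesis by auto
  qed
  then obtain D where D: "\<And>\<nu> z. \<nu> \<in> S \<Longrightarrow> \<bar>z\<bar> \<le> R \<Longrightarrow>
      \<bar>poly p z - (if \<nu> = \<mu> then (z - \<mu>) ^ k else 0)\<bar> \<le> D \<nu> * \<bar>z - \<nu>\<bar> ^ N"
    by metis
  define E where "E = (\<Sum>\<nu>\<in>S. \<bar>D \<nu>\<bar>)"
  let ?f = "\<lambda>e. \<Sum>z\<in>#filter_mset (\<lambda>z. \<bar>z - \<mu>\<bar> < g) (L e). (z - \<mu>) ^ k"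
  let ?g = "\<lambda>e. \<Sum>z\<in>#L e. poly p z"
  have "(\<lambda>e. ?f e - ?g e) \<in> O[at 0](\<lambda>e. e ^ N)"
  proof (rule bigoI)
    show "\<forall>\<^sub>F e in at 0. norm (?f e - ?g e) \<le> (real n * (E * \<bar>C\<bar> ^ N)) * norm (e ^ N)"
      using R size near
    proof eventually_elim
      case (elim e)
      have "?f e = (\<Sum>z\<in>#L e. if \<bar>z - \<mu>\<bar> < g then (z - \<mu>) ^ k else 0)"
        by (rule sum_mset_filter)
      then have "?f e - ?g e = - (\<Sum>z\<in>#L e. poly p z - (if \<bar>z - \<mu>\<bar> < g then (z - \<mu>) ^ k else 0))"
        by (simp add: sum_mset_subtract)
      also have "\<bar>\<dots>\<bar> \<le> real (size (L e)) * (E * (\<bar>C\<bar> * \<bar>e\<bar>) ^ N)"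
        unfolding abs_minus_cancel
      proof (rule sum_mset_abs_bound)
        fix z assume z: "z \<in># L e"
        then obtain \<nu> where \<nu>: "\<nu> \<in> S" "\<bar>z - \<nu>\<bar> \<le> C * \<bar>e\<bar>" "\<bar>z - \<mu>\<bar> < g \<longleftrightarrow> \<nu> = \<mu>" using elim by blast
        have "\<bar>poly p z - (if \<bar>z - \<mu>\<bar> < g then (z - \<mu>) ^ k else 0)\<bar> \<le> D \<nu> * \<bar>z - \<nu>\<bar> ^ N"
          using D[OF \<nu>(1), of z] elim(1) z \<nu>(3) by auto
        also have "\<dots> \<le> \<bar>D \<nu>\<bar> * \<bar>z - \<nu>\<bar> ^ N" by (intro mult_right_mono) auto
        also have "\<dots> \<le> E * \<bar>z - \<nu>\<bar> ^ N"
          unfolding E_def using S \<nu>(1) by (intro mult_right_mono member_le_sum) auto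
        also have "\<dots> \<le> E * (\<bar>C\<bar> * \<bar>e\<bar>) ^ N"
        proof (intro mult_left_mono power_mono)
          show "\<bar>z - \<nu>\<bar> \<le> \<bar>C\<bar> * \<bar>e\<bar>"
            using \<nu>(2) mult_right_mono[OF abs_ge_self[of C], of "\<bar>e\<bar>"] by simp
        qed (auto simp: E_def intro: sum_nonneg)
        finally show "\<bar>poly p z - (if \<bar>z - \<mu>\<bar> < g then (z - \<mu>) ^ k else 0)\<bar> \<le> E * (\<bar>C\<bar> * \<bar>e\<bar>) ^ N" .
      qed
      finally show ?case using elim(2) by (simp add: power_mult_distrib power_abs mult_ac)
    qed
  qed
  moreover have "has_expansions ?g" by (intro has_expansions_sum_mset_poly ps)
  ultimately show "\<exists>g'. has_expansions g' \<and> (\<lambda>e. ?f e - g' e) \<in> O[at 0](\<lambda>e. e ^ N)" by blast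
qed

lemma mset_filter_partition:
  assumes "finite S" "\<And>z. z \<in># A \<Longrightarrow> \<exists>!\<mu>. \<mu> \<in> S \<and> P \<mu> z"
  shows "A = (\<Sum>\<mu>\<in>S. filter_mset (P \<mu>) A)"
proof (rule multiset_eqI)
  fix z
  have "count (\<Sum>\<mu>\<in>S. filter_mset (P \<mu>) A) z = (\<Sum>\<mu>\<in>S. if P \<mu> z then count A z else 0)"
    by (simp add: count_sum)
  also have "\<dots> = count A z"
  proof (cases "z \<in># A")
    case True
    from assms(2)[OF this] obtain \<mu> where \<mu>: "\<mu> \<in> S" "P \<mu> z" "\<And>\<nu>. \<nu> \<in> S \<Longrightarrow> P \<nu> z \<Longrightarrow> \<nu> = \<mu>"
      by (elim ex1E) blast
    have "(\<Sum>\<nu>\<in>S. if P \<nu> z then count A z else 0) = (\<Sum>\<nu>\<in>S. if \<nu> = \<mu> then count A z else 0)"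
    proof (intro sum.cong refl)
      fix \<nu> assume "\<nu> \<in> S"
      then have "P \<nu> z \<longleftrightarrow> \<nu> = \<mu>" using \<mu> by blast
      then show "(if P \<nu> z then count A z else 0) = (if \<nu> = \<mu> then count A z else 0)" by simp
    qed
    then show ?thesis using assms(1) \<mu>(1) by simp
  next
    case False
    then have "count A z = 0" by (simp add: not_in_iff)
    then show ?thesis by (simp add: sum.neutral)
  qed
  finally show "count A z = count (\<Sum>\<mu>\<in>S. filter_mset (P \<mu>) A) z" ..
qed

text \<open>Naturals are at least 1 apart. Applied to the zeroth power sum of a cluster, this fixes
  its cardinality on both sides of 0, as the induction over rescaled clusters requires.\<close>

lemma nat_valued_limit_eventually_const:
  assumes "((\<lambda>e. real (f e)) \<longlongrightarrow> l) F"
  shows "\<exists>n. \<forall>\<^sub>F e in F. f e = n"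
proof -
  have "\<forall>\<^sub>F e in F. dist (real (f e)) l < 1 / 2" using assms by (rule tendstoD) simp
  then have "\<forall>\<^sub>F e in F. f e = nat (round l)"
  proof eventually_elim
    case (elim e)
    then have "round l = int (f e)" by (intro round_unique') (auto simp: dist_real_def abs_minus_commute)
    then show ?case by simp
  qed
  then show ?thesis by blast
qed

text \<open>\<open>rel_mset\<close> lets the matching of points and polynomials vary with
  \<open>e\<close>, so no consistent labelling has to be chosen. Each induction step gains one
  order: the points of the cluster at \<open>\<mu>\<close> are \<open>\<mu> + e w\<close>, with
  \<open>w\<close> from a multiset that satisfies the assumptions again.\<close>

theorem power_sums_imp_expansions:
  fixes L :: "real \<Rightarrow> real multiset"
  assumes "\<forall>\<^sub>F e in at 0. size (L e) = n"
    and "\<And>k. has_expansions (\<lambda>e. \<Sum>z\<in>#L e. z ^ k)"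
  shows "\<exists>qs C. \<forall>\<^sub>F e in at 0. rel_mset (\<lambda>z q. \<bar>z - poly q e\<bar> \<le> C * \<bar>e\<bar> ^ m) (L e) qs"
  using assms
proof (induction m arbitrary: L n)
  case 0
  obtain R where "\<forall>\<^sub>F e in at 0. \<forall>z\<in>#L e. \<bar>z\<bar> \<le> R" using power_sums_bounded[OF 0(2)] by blast
  with 0(1) have "\<forall>\<^sub>F e in at 0. rel_mset (\<lambda>z q. \<bar>z - poly q e\<bar> \<le> R * \<bar>e\<bar> ^ 0) (L e) (replicate_mset n 0)"
  proof eventually_elim
    case (elim e)
    then show ?case using rel_mset_replicate[of "L e" "\<lambda>z q. \<bar>z - poly q e\<bar> \<le> R * \<bar>e\<bar> ^ 0" 0] by auto
  qed
  then show ?case by blast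
next
  case (Suc m)
  note size = Suc.prems(1) and ps = Suc.prems(2)
  obtain S C0 where S: "finite S" and C0: "\<forall>\<^sub>F e in at 0. \<forall>z\<in>#L e. \<exists>\<mu>\<in>S. \<bar>z - \<mu>\<bar> \<le> C0 * \<bar>e\<bar>"
    using power_sums_cluster_points[OF size ps] by blast
  obtain g where g: "g > 0" "\<And>\<mu> \<nu>. \<mu> \<in> S \<Longrightarrow> \<nu> \<in> S \<Longrightarrow> \<mu> \<noteq> \<nu> \<Longrightarrow> 2 * g \<le> \<bar>\<mu> - \<nu>\<bar>"
    using finite_set_separated[OF S] by blast
  have "((\<lambda>e. C0 * \<bar>e\<bar>) \<longlongrightarrow> C0 * \<bar>0\<bar>) (at 0)" by (intro tendsto_intros)
  then have "\<forall>\<^sub>F e in at 0. C0 * \<bar>e\<bar> < g" using g(1) by (intro order_tendstoD) auto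
  with C0 have near: "\<forall>\<^sub>F e in at 0. \<forall>z\<in>#L e. \<exists>\<nu>\<in>S. \<bar>z - \<nu>\<bar> \<le> C0 * \<bar>e\<bar> \<and> (\<forall>\<mu>\<in>S. \<bar>z - \<mu>\<bar> < g \<longleftrightarrow> \<nu> = \<mu>)"
  proof eventually_elim
    case (elim e)
    show ?case
    proof
      fix z assume "z \<in># L e"
      then obtain \<nu> where \<nu>: "\<nu> \<in> S" "\<bar>z - \<nu>\<bar> \<le> C0 * \<bar>e\<bar>" using elim by blast
      then have "\<bar>z - \<nu>\<bar> < g" using elim by linarith
      then have "\<bar>z - \<mu>\<bar> < g \<longleftrightarrow> \<nu> = \<mu>" if "\<mu> \<in> S" for \<mu> using g(2)[OF \<nu>(1) that] by (cases "\<nu> = \<mu>") auto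
      with \<nu> show "\<exists>\<nu>\<in>S. \<bar>z - \<nu>\<bar> \<le> C0 * \<bar>e\<bar> \<and> (\<forall>\<mu>\<in>S. \<bar>z - \<mu>\<bar> < g \<longleftrightarrow> \<nu> = \<mu>)" by blast
    qed
  qed
  define A where "A = (\<lambda>\<mu> e. filter_mset (\<lambda>z. \<bar>z - \<mu>\<bar> < g) (L e))"
  have "\<exists>qs C. \<forall>\<^sub>F e in at 0. rel_mset (\<lambda>z q. \<bar>z - poly q e\<bar> \<le> C * \<bar>e\<bar> ^ Suc m) (A \<mu> e) qs" if \<mu>: "\<mu> \<in> S" for \<mu>
  proof -
    have G: "has_expansions (\<lambda>e. \<Sum>z\<in>#A \<mu> e. (z - \<mu>) ^ k)" for k
      unfolding A_def
    proof (rule cluster_power_sums[OF ps size S \<mu>])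
      show "\<forall>\<^sub>F e in at 0. \<forall>z\<in>#L e. \<exists>\<nu>\<in>S. \<bar>z - \<nu>\<bar> \<le> C0 * \<bar>e\<bar> \<and> (\<bar>z - \<mu>\<bar> < g \<longleftrightarrow> \<nu> = \<mu>)"
        using near by eventually_elim (use \<mu> in blast)
    qed
    have "(\<lambda>e. \<Sum>z\<in>#A \<mu> e. (z - \<mu>) ^ 0) = (\<lambda>e. real (size (A \<mu> e)))" by simp
    with has_expansions_limit[OF G[of 0]] obtain l where "((\<lambda>e. real (size (A \<mu> e))) \<longlongrightarrow> l) (at 0)" by metis
    then obtain n' where n': "\<forall>\<^sub>F e in at 0. size (A \<mu> e) = n'"
      using nat_valued_limit_eventually_const[of "\<lambda>e. size (A \<mu> e)"] by blast
    define N where "N = (\<lambda>e. image_mset (\<lambda>z. (z - \<mu>) / e) (A \<mu> e))"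
    have "has_expansions (\<lambda>e. \<Sum>w\<in>#N e. w ^ k)" for k
    proof -
      \<comment> \<open>All points of the cluster are within \<open>O(e)\<close> of
        \<open>\<mu>\<close>, so the centred \<open>k\<close>-th power sum may be divided by
        \<open>e ^ k\<close>; the quotient is the power sum of the rescaled points.\<close>
      have "(\<lambda>e. \<Sum>z\<in>#A \<mu> e. (z - \<mu>) ^ k) \<in> O[at 0](\<lambda>e. e ^ k)"
      proof (rule bigoI)
        show "\<forall>\<^sub>F e in at 0. norm (\<Sum>z\<in>#A \<mu> e. (z - \<mu>) ^ k) \<le> (real n' * \<bar>C0\<bar> ^ k) * norm (e ^ k)"
          using n' near
        proof eventually_elim
          case (elim e)
          have "\<bar>\<Sum>z\<in>#A \<mu> e. (z - \<mu>) ^ k\<bar> \<le> real (size (A \<mu> e)) * (\<bar>C0\<bar> * \<bar>e\<bar>) ^ k"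
          proof (rule sum_mset_abs_bound)
            fix z assume "z \<in># A \<mu> e"
            then have z: "z \<in># L e" "\<bar>z - \<mu>\<bar> < g" by (auto simp: A_def)
            obtain \<nu> where "\<bar>z - \<nu>\<bar> \<le> C0 * \<bar>e\<bar>" "\<forall>\<mu>\<in>S. \<bar>z - \<mu>\<bar> < g \<longleftrightarrow> \<nu> = \<mu>"
              using elim(2) z(1) by blast
            with z(2) \<mu> have "\<bar>z - \<mu>\<bar> \<le> C0 * \<bar>e\<bar>" by simp
            also have "\<dots> \<le> \<bar>C0\<bar> * \<bar>e\<bar>" by (intro mult_right_mono) auto
            finally show "\<bar>(z - \<mu>) ^ k\<bar> \<le> (\<bar>C0\<bar> * \<bar>e\<bar>) ^ k" unfolding power_abs by (intro power_mono) auto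
          qed
          then show ?case using elim(1) by (simp add: power_mult_distrib power_abs mult_ac)
        qed
      qed
      from has_expansions_divide_power[OF G this] show ?thesis
        by (simp add: N_def multiset.map_comp o_def divide_inverse power_mult_distrib power_inverse sum_mset_distrib_right)
    qed
    moreover have "\<forall>\<^sub>F e in at 0. size (N e) = n'" using n' by (simp add: N_def)
    ultimately obtain qs C where "\<forall>\<^sub>F e in at 0. rel_mset (\<lambda>w q. \<bar>w - poly q e\<bar> \<le> C * \<bar>e\<bar> ^ m) (N e) qs"
      using Suc.IH[of N n'] by blast
    moreover have "\<forall>\<^sub>F e::real in at 0. e \<noteq> 0" by (rule eventually_neq_at_within)
    \<comment> \<open>\<open>pCons \<mu> q\<close> is the polynomial \<open>\<mu> + e q(e)\<close>:
      undoing the rescaling multiplies the error by \<open>e\<close>.\<close>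
    ultimately have "\<forall>\<^sub>F e in at 0. rel_mset (\<lambda>z q. \<bar>z - poly q e\<bar> \<le> C * \<bar>e\<bar> ^ Suc m) (A \<mu> e) (image_mset (pCons \<mu>) qs)"
    proof eventually_elim
      case (elim e)
      have "\<bar>z - poly (pCons \<mu> q) e\<bar> \<le> C * \<bar>e\<bar> ^ Suc m" if "\<bar>(z - \<mu>) / e - poly q e\<bar> \<le> C * \<bar>e\<bar> ^ m" for z q
      proof -
        have "z - poly (pCons \<mu> q) e = e * ((z - \<mu>) / e - poly q e)" using elim(2) by (simp add: field_simps)
        then have "\<bar>z - poly (pCons \<mu> q) e\<bar> = \<bar>e\<bar> * \<bar>(z - \<mu>) / e - poly q e\<bar>" by (simp only: abs_mult)
        also have "\<dots> \<le> \<bar>e\<bar> * (C * \<bar>e\<bar> ^ m)" using that by (intro mult_left_mono) auto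
        finally show ?thesis by (simp add: mult_ac)
      qed
      with elim(1) show ?case
        unfolding N_def multiset.rel_map by (auto elim!: multiset.rel_mono_strong)
    qed
    then show ?thesis by blast
  qed
  then have "\<forall>\<mu>\<in>S. \<exists>p. \<forall>\<^sub>F e in at 0. rel_mset (\<lambda>z q. \<bar>z - poly q e\<bar> \<le> snd p * \<bar>e\<bar> ^ Suc m) (A \<mu> e) (fst p)"
    by (auto simp: split_paired_Ex)
  from bchoice[OF this] obtain p where
    p: "\<forall>\<mu>\<in>S. \<forall>\<^sub>F e in at 0. rel_mset (\<lambda>z q. \<bar>z - poly q e\<bar> \<le> snd (p \<mu>) * \<bar>e\<bar> ^ Suc m) (A \<mu> e) (fst (p \<mu>))"
    by blast
  define C where "C = (\<lambda>\<mu>. snd (p \<mu>))"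
  define qs where "qs = (\<lambda>\<mu>. fst (p \<mu>))"
  have qsC: "\<forall>\<^sub>F e in at 0. rel_mset (\<lambda>z q. \<bar>z - poly q e\<bar> \<le> C \<mu> * \<bar>e\<bar> ^ Suc m) (A \<mu> e) (qs \<mu>)" if "\<mu> \<in> S" for \<mu>
    using p that by (simp add: C_def qs_def)
  then have "\<forall>\<^sub>F e in at 0. \<forall>\<mu>\<in>S. rel_mset (\<lambda>z q. \<bar>z - poly q e\<bar> \<le> C \<mu> * \<bar>e\<bar> ^ Suc m) (A \<mu> e) (qs \<mu>)"
    using S by (intro eventually_ball_finite) auto
  with near have "\<forall>\<^sub>F e in at 0. rel_mset (\<lambda>z q. \<bar>z - poly q e\<bar> \<le> (\<Sum>\<mu>\<in>S. \<bar>C \<mu>\<bar>) * \<bar>e\<bar> ^ Suc m) (L e) (\<Sum>\<mu>\<in>S. qs \<mu>)"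
  proof eventually_elim
    case (elim e)
    have L: "L e = (\<Sum>\<mu>\<in>S. A \<mu> e)" unfolding A_def
    proof (rule mset_filter_partition[OF S])
      fix z assume "z \<in># L e"
      then obtain \<nu> where "\<nu> \<in> S" "\<forall>\<mu>\<in>S. \<bar>z - \<mu>\<bar> < g \<longleftrightarrow> \<nu> = \<mu>" using elim(1) by blast
      then show "\<exists>!\<mu>. \<mu> \<in> S \<and> \<bar>z - \<mu>\<bar> < g" by (intro ex1I[of _ \<nu>]) auto
    qed
    have "rel_mset (\<lambda>z q. \<bar>z - poly q e\<bar> \<le> (\<Sum>\<mu>\<in>S. \<bar>C \<mu>\<bar>) * \<bar>e\<bar> ^ Suc m) (A \<mu> e) (qs \<mu>)" if "\<mu> \<in> S" for \<mu>
    proof -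
      have "C \<mu> \<le> \<bar>C \<mu>\<bar>" by simp
      also have "\<dots> \<le> (\<Sum>\<mu>\<in>S. \<bar>C \<mu>\<bar>)" using S that by (intro member_le_sum) auto
      finally have "C \<mu> * \<bar>e\<bar> ^ Suc m \<le> (\<Sum>\<mu>\<in>S. \<bar>C \<mu>\<bar>) * \<bar>e\<bar> ^ Suc m" by (intro mult_right_mono) auto
      with elim(2) that show ?thesis by (auto elim!: multiset.rel_mono_strong intro: order_trans)
    qed
    then show ?case unfolding L by (intro rel_mset_sum)
  qed
  then show ?case by blast
qed

section \<open>Ordered eigenvalues of analytic families\<close>

text \<open>Splitting off the power of \<open>e\<close> leaves a factor that is nonzero at 0 and
  keeps its sign nearby; for \<open>e > 0\<close> the split-off power is positive.\<close>

lemma poly_sgn_eventually_const: "\<exists>\<sigma>. \<forall>\<^sub>F e in at_right 0. sgn (poly p e) = (\<sigma> :: real)"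
proof (cases "p = 0")
  case False
  then obtain q where q: "p = [:- 0, 1:] ^ order 0 p * q" "\<not> [:- 0, 1:] dvd q" using order_decomp by blast
  then have q0: "poly q 0 \<noteq> 0" by (simp add: poly_eq_0_iff_dvd)
  have "((\<lambda>e. sgn (poly q e)) \<longlongrightarrow> sgn (poly q 0)) (at_right 0)"
    using q0 by (intro tendsto_intros)
  then have "\<forall>\<^sub>F e in at_right 0. dist (sgn (poly q e)) (sgn (poly q 0)) < 1 / 2" by (rule tendstoD) simp
  then have "\<forall>\<^sub>F e in at_right 0. sgn (poly p e) = sgn (poly q 0)"
    using eventually_at_right_less[of 0]
  proof eventually_elim
    case (elim e)
    have "sgn (poly p e) = sgn (poly q e)" by (subst q(1)) (use elim in \<open>simp add: sgn_mult\<close>)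
    with elim q0 show ?case by (auto simp: sgn_real_def dist_real_def split: if_splits)
  qed
  then show ?thesis by blast
qed (auto intro!: exI[of _ 0])

text \<open>All pairwise differences have eventually constant sign to the right of 0. Sorting by the
  values at a single point \<open>d\<close> where these signs already hold gives an order valid for
  all small \<open>e > 0\<close>.\<close>

lemma poly_mset_eventually_sorted:
  fixes Q :: "real poly multiset"
  shows "\<exists>ps. mset ps = Q \<and> (\<forall>\<^sub>F e in at_right 0. \<forall>i j. i \<le> j \<and> j < length ps \<longrightarrow> poly (ps ! j) e \<le> poly (ps ! i) e)"
proof -
  have "\<forall>p. \<exists>\<sigma>. \<forall>\<^sub>F e in at_right 0. sgn (poly p e) = (\<sigma> :: real)" using poly_sgn_eventually_const by blast
  from choice[OF this] obtain \<sigma> where \<sigma>: "\<And>p. \<forall>\<^sub>F e in at_right 0. sgn (poly p e) = (\<sigma> p :: real)" by blast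
  have ev: "\<forall>\<^sub>F e in at_right 0. \<forall>p\<in>set_mset Q. \<forall>q\<in>set_mset Q. sgn (poly (p - q) e) = \<sigma> (p - q)"
    by (intro eventually_ball_finite ballI \<sigma>) auto
  then obtain d where d: "\<forall>p\<in>set_mset Q. \<forall>q\<in>set_mset Q. sgn (poly (p - q) d) = \<sigma> (p - q)"
    using eventually_happens'[OF trivial_limit_at_right_real] by blast
  obtain qs where qs: "mset qs = Q" using ex_mset by blast
  define ps where "ps = sort_key (\<lambda>q. - poly q d) qs"
  have ps: "mset ps = Q" by (simp add: ps_def qs)
  have sd: "poly (ps ! j) d \<le> poly (ps ! i) d" if "i \<le> j" "j < length ps" for i j
    using sorted_nth_mono[OF sorted_sort_key[of "\<lambda>q. - poly q d" qs], of i j] that by (simp add: ps_def)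
  from ev have "\<forall>\<^sub>F e in at_right 0. \<forall>i j. i \<le> j \<and> j < length ps \<longrightarrow> poly (ps ! j) e \<le> poly (ps ! i) e"
  proof eventually_elim
    case (elim e)
    show ?case
    proof (intro allI impI)
      fix i j assume ij: "i \<le> j \<and> j < length ps"
      then have "ps ! i \<in> set ps" "ps ! j \<in> set ps" by auto
      then have "ps ! i \<in># Q" "ps ! j \<in># Q" using ps by (metis set_mset_mset)+
      with elim d have "sgn (poly (ps ! i - ps ! j) e) = sgn (poly (ps ! i - ps ! j) d)" by metis
      moreover have "sgn (poly (ps ! i - ps ! j) d) \<ge> 0" using sd[of i j] ij by simp
      ultimately have "sgn (poly (ps ! i - ps ! j) e) \<ge> 0" by simp
      then show "poly (ps ! j) e \<le> poly (ps ! i) e" by simp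
    qed
  qed
  with ps show ?thesis by blast
qed

text \<open>Counting: if the bound failed, the first \<open>i + 1\<close> entries of
  \<open>xs\<close> would exceed \<open>ys ! i + \<delta>\<close>, so their partners would exceed
  \<open>ys ! i\<close>; but at most \<open>i\<close> entries of \<open>ys\<close> do.\<close>

lemma sorted_matching_le:
  fixes xs ys as bs :: "real list"
  assumes ab: "mset as = mset xs" "mset bs = mset ys" "list_all2 (\<lambda>a b. a \<le> b + \<delta>) as bs"
    and xs: "\<And>j. j \<le> i \<Longrightarrow> xs ! i \<le> xs ! j"
    and ys: "\<And>j. i \<le> j \<Longrightarrow> j < length ys \<Longrightarrow> ys ! j \<le> ys ! i" and i: "i < length xs"
  shows "xs ! i \<le> ys ! i + \<delta>"
proof (rule ccontr)
  assume *: "\<not> xs ! i \<le> ys ! i + \<delta>"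
  let ?P = "\<lambda>a. ys ! i + \<delta> < a" and ?Q = "\<lambda>b. ys ! i < b"
  have "card {..i} \<le> length (filter ?P xs)"
    unfolding length_filter_conv_card
  proof (intro card_mono)
    show "{..i} \<subseteq> {j. j < length xs \<and> ?P (xs ! j)}" using xs i * by fastforce
  qed auto
  also have "length (filter ?P xs) = length (filter ?P as)"
    using ab(1) by (metis mset_filter size_mset)
  also have "\<dots> \<le> length (filter ?Q bs)"
    using ab(3) by (induction rule: list_all2_induct) auto
  also have "\<dots> = length (filter ?Q ys)"
    using ab(2) by (metis mset_filter size_mset)
  also have "\<dots> \<le> card {..<i}"
    unfolding length_filter_conv_card
  proof (intro card_mono)
    show "{j. j < length ys \<and> ?Q (ys ! j)} \<subseteq> {..<i}" using ys by (force simp flip: not_le)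
  qed auto
  finally show False by simp
qed

text \<open>Turns the unlabelled matching given by \<open>rel_mset\<close> into a bound at each
  index, by the one-sided estimate in both directions.\<close>

lemma sorted_matching:
  fixes xs ys :: "real list"
  assumes rel: "rel_mset (\<lambda>a b. \<bar>a - b\<bar> \<le> \<delta>) (mset xs) (mset ys)"
    and xs: "\<And>i j. i \<le> j \<Longrightarrow> j < length xs \<Longrightarrow> xs ! j \<le> xs ! i"
    and ys: "\<And>i j. i \<le> j \<Longrightarrow> j < length ys \<Longrightarrow> ys ! j \<le> ys ! i" and i: "i < length xs"
  shows "\<bar>xs ! i - ys ! i\<bar> \<le> \<delta>"
proof -
  obtain as bs where ab: "mset as = mset xs" "mset bs = mset ys" "list_all2 (\<lambda>a b. \<bar>a - b\<bar> \<le> \<delta>) as bs"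
    using rel unfolding rel_mset_def by blast
  have len: "length xs = length ys" using rel_mset_size[OF rel] by simp
  have "list_all2 (\<lambda>a b. a \<le> b + \<delta>) as bs"
    using ab(3) by (rule list_all2_mono) auto
  then have "xs ! i \<le> ys ! i + \<delta>" using xs ys i ab by (intro sorted_matching_le[of as xs bs ys]) auto
  moreover have "list_all2 (\<lambda>b a. b \<le> a + \<delta>) bs as"
    using ab(3) by (auto simp: list_all2_conv_all_nth abs_le_iff)
  then have "ys ! i \<le> xs ! i + \<delta>" using xs ys i ab len by (intro sorted_matching_le[of bs ys as xs]) auto
  ultimately show ?thesis by linarith
qed

text \<open>\<open>lam\<close> is controlled only for \<open>e > 0\<close>, while the expansions
  need both sides of 0. The two-sided object is the multiset of characteristic roots;
  \<open>lam\<close> enters at the end, once the polynomials have been sorted for small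
  \<open>e > 0\<close>.\<close>

lemma symmetric_family_eigenvalue_expansions:
  fixes A :: "real \<Rightarrow> real mat" and lam :: "nat \<Rightarrow> real \<Rightarrow> real"
  assumes A: "\<And>e. A e \<in> carrier_mat n n"
    and exp: "\<And>i j. i < n \<Longrightarrow> j < n \<Longrightarrow> has_expansions (\<lambda>e. A e $$ (i, j))"
    and sym: "\<forall>\<^sub>F e in at 0. transpose_mat (A e) = A e"
    and lam: "\<forall>\<^sub>F e in at_right 0. (\<forall>i j. i \<le> j \<and> j < n \<longrightarrow> lam j e \<le> lam i e) \<and>
      char_poly (A e) = (\<Prod>a\<leftarrow>map (\<lambda>i. lam i e) [0..<n]. [:- a, 1:])"
  shows "\<exists>p. \<forall>i<n. (\<lambda>e. lam i e - poly (p i) e) \<in> O[at_right 0](\<lambda>e. e ^ m)"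
proof -
  \<comment> \<open>\<open>proots\<close> counts the real roots with multiplicity; symmetry on both
    sides of 0 guarantees that there are \<open>n\<close> of them.\<close>
  define L where "L = (\<lambda>e. proots (char_poly (A e)))"
  have L: "L e = mset es" if "char_poly (A e) = (\<Prod>a\<leftarrow>es. [:- a, 1:])" for e es
  proof -
    have "proots (\<Prod>p\<leftarrow>map (\<lambda>a. [:- a, 1:]) es. p) = (\<Sum>p\<leftarrow>map (\<lambda>a. [:- a, 1:]) es. proots p)"
      by (rule proots_prod_list) auto
    also have "\<dots> = mset es" by (induction es) auto
    finally show ?thesis using that by (simp add: L_def)
  qed
  have size: "\<forall>\<^sub>F e in at 0. size (L e) = n"
    using sym
  proof eventually_elim
    case (elim e)
    from symmetric_char_poly_splits[OF A elim] L show ?case by auto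
  qed
  have ps: "has_expansions (\<lambda>e. \<Sum>z\<in>#L e. z ^ k)" for k
  proof (rule has_expansions_cong)
    have "has_expansions (\<lambda>e. (A e ^\<^sub>m k) $$ (i, j))" if "i < n" "j < n" for i j
      using that
    proof (induction k arbitrary: i j)
      case 0
      then show ?case using A by (auto intro!: has_expansions_const simp: carrier_matD[OF A])
    next
      case (Suc k)
      have "(A e ^\<^sub>m Suc k) $$ (i, j) = (\<Sum>l<n. (A e ^\<^sub>m k) $$ (i, l) * A e $$ (l, j))" for e
        using Suc.prems carrier_matD[OF A] by (simp add: scalar_prod_def lessThan_atLeast0)
      then show ?case using Suc by (simp, intro has_expansions_sum has_expansions_mult Suc.IH exp) auto
    qed
    then show "has_expansions (\<lambda>e. \<Sum>i<n. (A e ^\<^sub>m k) $$ (i, i))" by (intro has_expansions_sum) auto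
    from sym show "\<forall>\<^sub>F e in at 0. (\<Sum>z\<in>#L e. z ^ k) = (\<Sum>i<n. (A e ^\<^sub>m k) $$ (i, i))"
    proof eventually_elim
      case (elim e)
      obtain es where es: "char_poly (A e) = (\<Prod>a\<leftarrow>es. [:- a, 1:])" "length es = n"
        using symmetric_char_poly_splits[OF A elim] by blast
      obtain U where U: "ortho_mat n U" "transpose_mat U * A e * U = mat_diag n ((!) es)"
        using spectral_decomposition[OF A elim es] by blast
      have "(\<Sum>z\<in>#L e. z ^ k) = (\<Sum>i<n. (es ! i) ^ k)"
        unfolding L[OF es(1)] using es(2)
        by (simp flip: mset_map add: sum_mset_sum_list sum_list_sum_nth lessThan_atLeast0)
      then show ?case using sum_power_eigenvalues[OF U(1) A U(2)] by simp
    qed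
  qed
  obtain Q C where QC: "\<forall>\<^sub>F e in at 0. rel_mset (\<lambda>z q. \<bar>z - poly q e\<bar> \<le> C * \<bar>e\<bar> ^ m) (L e) Q"
    using power_sums_imp_expansions[OF size ps] by blast
  obtain qs where qs: "mset qs = Q"
    "\<forall>\<^sub>F e in at_right 0. \<forall>i j. i \<le> j \<and> j < length qs \<longrightarrow> poly (qs ! j) e \<le> poly (qs ! i) e"
    using poly_mset_eventually_sorted[of Q] by blast
  have "\<forall>\<^sub>F e in at_right 0. rel_mset (\<lambda>z q. \<bar>z - poly q e\<bar> \<le> C * \<bar>e\<bar> ^ m) (L e) Q"
    using QC by (simp add: eventually_at_split)
  then have ev: "\<forall>\<^sub>F e in at_right 0. \<forall>i\<in>{..<n}. \<bar>lam i e - poly (qs ! i) e\<bar> \<le> C * \<bar>e\<bar> ^ m"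
    using lam qs(2)
  proof eventually_elim
    case (elim e)
    show ?case
    proof
      fix i assume i: "i \<in> {..<n}"
      let ?xs = "map (\<lambda>i. lam i e) [0..<n]" and ?ys = "map (\<lambda>q. poly q e) qs"
      have Le: "L e = mset ?xs" using elim(2) by (intro L) blast
      have rel: "rel_mset (\<lambda>a b. \<bar>a - b\<bar> \<le> C * \<bar>e\<bar> ^ m) (mset ?xs) (mset ?ys)"
        using elim(1) unfolding Le qs(1)[symmetric] mset_map[of "\<lambda>q. poly q e"] multiset.rel_map(2) .
      have len: "length qs = n" using rel_mset_size[OF rel] by simp
      have "\<bar>?xs ! i - ?ys ! i\<bar> \<le> C * \<bar>e\<bar> ^ m"
        using rel by (rule sorted_matching) (use elim i len in auto)
      then show "\<bar>lam i e - poly (qs ! i) e\<bar> \<le> C * \<bar>e\<bar> ^ m" using i len by simp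
    qed
  qed
  have "(\<lambda>e. lam i e - poly (qs ! i) e) \<in> O[at_right 0](\<lambda>e. e ^ m)" if "i < n" for i
    using ev that by (intro bigoI[of _ C]) (auto elim!: eventually_mono simp: power_abs)
  then show ?thesis by (intro exI[of _ "(!) qs"]) auto
qed

section \<open>Graded families of matrices\<close>

lemma tendsto_det:
  fixes A :: "'b \<Rightarrow> real mat"
  assumes A: "\<And>e. A e \<in> carrier_mat n n" "A0 \<in> carrier_mat n n"
    and lim: "\<And>i j. i < n \<Longrightarrow> j < n \<Longrightarrow> ((\<lambda>e. A e $$ (i, j)) \<longlongrightarrow> A0 $$ (i, j)) F"
  shows "((\<lambda>e. det (A e)) \<longlongrightarrow> det A0) F"
  unfolding det_def'[OF A(1)] det_def'[OF A(2)]
proof (intro tendsto_intros lim)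
  fix p i assume p: "p \<in> {p. p permutes {0..<n}}" and i: "i \<in> {0..<n}"
  then show "i < n" by simp
  have "p i \<in> {0..<n}" using p i by (metis mem_Collect_eq permutes_in_image)
  then show "p i < n" by simp
qed

text \<open>The factor \<open>1 + lam i / e ^ (2 s - 1)\<close> singles out the first \<open>s\<close> eigenvalues. Scaling row
  \<open>i\<close> by \<open>e ^ (s - i)\<close> and column \<open>j\<close> by \<open>e ^ (s - 1 - j)\<close>, with truncated subtraction in the
  exponents, makes \<open>1 + B / e ^ (2 s - 1)\<close> converge to a block lower triangular matrix.\<close>

lemma graded_eigenvalue_product:
  fixes B :: "real \<Rightarrow> real mat" and lam :: "nat \<Rightarrow> real \<Rightarrow> real"
  assumes B: "\<And>e. B e \<in> carrier_mat n n"
    and M: "\<And>i j. i < n \<Longrightarrow> j < n \<Longrightarrow> ((\<lambda>e. B e $$ (i, j) / e ^ (i + j)) \<longlongrightarrow> M i j) (at_right 0)"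
    and char: "\<forall>\<^sub>F e in at_right 0. \<forall>t. det (t \<cdot>\<^sub>m 1\<^sub>m n + B e) = (\<Prod>i<n. t + lam i e)"
    and lt: "\<And>i. i < n \<Longrightarrow> ((\<lambda>e. lam i e / e ^ (2 * i)) \<longlongrightarrow> lt i) (at_right 0)"
    and s: "0 < s" "s \<le> n"
  shows "(\<Prod>i<s. lt i) = det (mat s s (\<lambda>(i, j). M i j))"
proof -
  \<comment> \<open>\<open>2 * s - 1\<close> lies strictly between \<open>2 * (s - 1)\<close> and
    \<open>2 * s\<close>: eigenvalues of index at least \<open>s\<close> are negligible against
    \<open>\<tau> e\<close>, while \<open>\<tau> e\<close> is negligible on the scale
    \<open>e ^ (2 * i)\<close> for \<open>i < s\<close>.\<close>
  define \<tau> where "\<tau> = (\<lambda>e::real. e ^ (2 * s - 1))"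
  \<comment> \<open>\<open>\<rho>\<close> also carries the division by \<open>\<tau>\<close>. For
    \<open>i < s\<close> the exponents \<open>s - i\<close> and \<open>s - 1 - i\<close> add up to
    \<open>2 * (s - i) - 1\<close>, in total \<open>s ^ 2\<close>; for \<open>i >= s\<close> both
    truncate to 0.\<close>
  define \<rho> where "\<rho> = (\<lambda>(e::real) i. e ^ (s - i) / \<tau> e)"
  define \<gamma> where "\<gamma> = (\<lambda>(e::real) j. e ^ (s - 1 - j))"
  define C where "C = (\<lambda>e. mat_diag n (\<rho> e) * (\<tau> e \<cdot>\<^sub>m 1\<^sub>m n + B e) * mat_diag n (\<gamma> e))"
  \<comment> \<open>\<open>0 ^ k\<close> is 1 for \<open>k = 0\<close> and 0 otherwise, so it
    encodes which entries survive. The exponent at \<open>M i j\<close> is 0 for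
    \<open>i, j < s\<close> and positive for \<open>j >= s\<close>. For \<open>j < s <= i\<close> it
    equals \<open>i - s\<close>, so row \<open>s\<close> may survive and the limit is only block
    triangular.\<close>
  define C0 where "C0 = mat n n (\<lambda>(i, j). (if i = j then 0 ^ ((s - i) + (s - 1 - i)) else 0) +
    M i j * 0 ^ ((s - i) + (s - 1 - j) + (i + j) - (2 * s - 1)))"
  have C: "C e \<in> carrier_mat n n" for e unfolding C_def using B[of e] by (intro mult_carrier_mat[of _ n n]) auto
  have C0: "C0 \<in> carrier_mat n n" by (simp add: C0_def)
  have Cij: "C e $$ (i, j) = \<rho> e i * \<gamma> e j * ((if i = j then \<tau> e else 0) + B e $$ (i, j))" if "i < n" "j < n" for e i j
  proof -
    have X: "\<tau> e \<cdot>\<^sub>m 1\<^sub>m n + B e \<in> carrier_mat n n" using B[of e] by auto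
    show ?thesis
      unfolding C_def mat_diag_mult_left[OF X]
      by (subst mat_diag_mult_right[of _ n]) (use that carrier_matD[OF B] in auto)
  qed
  have "((\<lambda>e. C e $$ (i, j)) \<longlongrightarrow> C0 $$ (i, j)) (at_right 0)" if ij: "i < n" "j < n" for i j
  proof -
    define E where "E = (s - i) + (s - 1 - j) + (i + j) - (2 * s - 1)"
    \<comment> \<open>The sum is at least \<open>2 * s - 1\<close>, so the truncated subtraction in
      \<open>E\<close> is exact.\<close>
    have E: "(s - i) + (s - 1 - j) + (i + j) = E + (2 * s - 1)" unfolding E_def using s by auto
    have "((\<lambda>e. (if i = j then e ^ ((s - i) + (s - 1 - i)) else 0) + B e $$ (i, j) / e ^ (i + j) * e ^ E) \<longlongrightarrow>
        (if i = j then 0 ^ ((s - i) + (s - 1 - i)) else 0) + M i j * 0 ^ E) (at_right 0)"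
    proof (intro tendsto_add tendsto_mult M[OF ij])
      show "((\<lambda>e. if i = j then e ^ ((s - i) + (s - 1 - i)) else 0) \<longlongrightarrow>
          (if i = j then 0 ^ ((s - i) + (s - 1 - i)) else 0)) (at_right (0 :: real))"
        by (cases "i = j") (auto intro!: tendsto_intros)
      show "((\<lambda>e. e ^ E) \<longlongrightarrow> 0 ^ E) (at_right (0 :: real))" by (intro tendsto_intros)
    qed
    moreover have "\<forall>\<^sub>F e in at_right 0. (if i = j then e ^ ((s - i) + (s - 1 - i)) else 0) +
        B e $$ (i, j) / e ^ (i + j) * e ^ E = C e $$ (i, j)"
      using eventually_at_right_less[of 0]
    proof eventually_elim
      case (elim e)
      have "e ^ (s - i) * e ^ (s - 1 - j) * e ^ (i + j) = e ^ E * \<tau> e"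
        unfolding \<tau>_def power_add[symmetric] E ..
      then have "e ^ (s - i) * e ^ (s - 1 - j) / \<tau> e = e ^ E / e ^ (i + j)"
        using elim by (simp add: \<tau>_def field_simps)
      then have "\<rho> e i * \<gamma> e j = e ^ E / e ^ (i + j)" by (simp add: \<rho>_def \<gamma>_def)
      moreover have "\<rho> e i * \<gamma> e i * \<tau> e = e ^ ((s - i) + (s - 1 - i))"
        using elim by (simp add: \<rho>_def \<gamma>_def \<tau>_def power_add)
      ultimately show ?case unfolding Cij[OF ij] ring_distribs by auto
    qed
    ultimately show ?thesis using ij by (auto simp: C0_def E_def elim: Lim_transform_eventually)
  qed
  then have detC: "((\<lambda>e. det (C e)) \<longlongrightarrow> det C0) (at_right 0)" by (intro tendsto_det[OF C C0])
  have factor: "((\<lambda>e. \<rho> e i * \<gamma> e i * (\<tau> e + lam i e)) \<longlongrightarrow> (if i < s then lt i else 1)) (at_right 0)" if i: "i < n" for i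
  proof (cases "i < s")
    case True
    have "((\<lambda>e. e ^ (2 * (s - i) - 1) + lam i e / e ^ (2 * i)) \<longlongrightarrow> 0 ^ (2 * (s - i) - 1) + lt i) (at_right 0)"
      using lt[OF i] by (intro tendsto_intros)
    moreover have "(0::real) ^ (2 * (s - i) - 1) = 0" using True by (intro zero_power) simp
    ultimately have "((\<lambda>e. e ^ (2 * (s - i) - 1) + lam i e / e ^ (2 * i)) \<longlongrightarrow> (if i < s then lt i else 1)) (at_right 0)"
      using True by (simp only: add_0_left if_True)
    moreover have "\<forall>\<^sub>F e in at_right 0. e ^ (2 * (s - i) - 1) + lam i e / e ^ (2 * i) = \<rho> e i * \<gamma> e i * (\<tau> e + lam i e)"
      using eventually_at_right_less[of 0]
    proof eventually_elim
      case (elim e)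
      have a: "(s - i) + (s - 1 - i) = 2 * (s - i) - 1" using True by auto
      have "\<tau> e = e ^ (2 * (s - i) - 1) * e ^ (2 * i)"
        unfolding \<tau>_def power_add[symmetric] using True by (intro arg_cong[where f = "power e"]) auto
      then have t: "e ^ (2 * (s - i) - 1) / \<tau> e = 1 / e ^ (2 * i)" "\<tau> e \<noteq> 0" using elim by (auto simp: field_simps)
      have "\<rho> e i * \<gamma> e i = e ^ (2 * (s - i) - 1) / \<tau> e"
        unfolding a[symmetric] power_add by (simp add: \<rho>_def \<gamma>_def)
      then have "\<rho> e i * \<gamma> e i * (\<tau> e + lam i e) = e ^ (2 * (s - i) - 1) / \<tau> e * \<tau> e + e ^ (2 * (s - i) - 1) / \<tau> e * lam i e"
        by (simp only: ring_distribs)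
      also have "\<dots> = e ^ (2 * (s - i) - 1) + lam i e / e ^ (2 * i)"
      proof -
        have "e ^ (2 * (s - i) - 1) / \<tau> e * \<tau> e = e ^ (2 * (s - i) - 1)" using t(2) by simp
        moreover have "e ^ (2 * (s - i) - 1) / \<tau> e * lam i e = lam i e / e ^ (2 * i)" unfolding t(1) by simp
        ultimately show ?thesis by (simp only:)
      qed
      finally show ?case by simp
    qed
    ultimately show ?thesis by (rule Lim_transform_eventually)
  next
    case False
    have "((\<lambda>e. 1 + lam i e / e ^ (2 * i) * e ^ (2 * (i - s) + 1)) \<longlongrightarrow> 1 + lt i * 0 ^ (2 * (i - s) + 1)) (at_right 0)"
      using lt[OF i] by (intro tendsto_intros)
    then have "((\<lambda>e. 1 + lam i e / e ^ (2 * i) * e ^ (2 * (i - s) + 1)) \<longlongrightarrow> (if i < s then lt i else 1)) (at_right 0)"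
      using False by simp
    moreover have "\<forall>\<^sub>F e in at_right 0. 1 + lam i e / e ^ (2 * i) * e ^ (2 * (i - s) + 1) = \<rho> e i * \<gamma> e i * (\<tau> e + lam i e)"
      using eventually_at_right_less[of 0]
    proof eventually_elim
      case (elim e)
      have "e ^ (2 * i) = e ^ (2 * (i - s) + 1) * \<tau> e"
        unfolding \<tau>_def power_add[symmetric] using False s by (intro arg_cong[where f = "power e"]) auto
      then have "e ^ (2 * (i - s) + 1) / e ^ (2 * i) = 1 / \<tau> e" using elim by (auto simp: field_simps)
      then have "1 + lam i e / e ^ (2 * i) * e ^ (2 * (i - s) + 1) = 1 + lam i e * (1 / \<tau> e)"
        by (metis times_divide_eq_left times_divide_eq_right)
      also have "\<dots> = \<rho> e i * \<gamma> e i * (\<tau> e + lam i e)"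
        using False elim by (simp add: \<rho>_def \<gamma>_def \<tau>_def field_simps)
      finally show ?case .
    qed
    ultimately show ?thesis by (rule Lim_transform_eventually)
  qed
  have "((\<lambda>e. \<Prod>i<n. \<rho> e i * \<gamma> e i * (\<tau> e + lam i e)) \<longlongrightarrow> (\<Prod>i<n. if i < s then lt i else 1)) (at_right 0)"
    using factor by (intro tendsto_prod) auto
  moreover have "\<forall>\<^sub>F e in at_right 0. (\<Prod>i<n. \<rho> e i * \<gamma> e i * (\<tau> e + lam i e)) = det (C e)"
    using char
  proof eventually_elim
    case (elim e)
    have X: "\<tau> e \<cdot>\<^sub>m 1\<^sub>m n + B e \<in> carrier_mat n n" using B[of e] by auto
    have "det (C e) = det (mat_diag n (\<rho> e)) * det (\<tau> e \<cdot>\<^sub>m 1\<^sub>m n + B e) * det (mat_diag n (\<gamma> e))"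
      unfolding C_def det_mult[OF mult_carrier_mat[OF mat_diag_dim X] mat_diag_dim] det_mult[OF mat_diag_dim X] ..
    then show ?case using elim by (simp add: det_mat_diag prod.distrib mult_ac)
  qed
  ultimately have "((\<lambda>e. det (C e)) \<longlongrightarrow> (\<Prod>i<n. if i < s then lt i else 1)) (at_right 0)"
    by (rule Lim_transform_eventually)
  from tendsto_unique[OF trivial_limit_at_right_real this detC]
  have "det C0 = (\<Prod>i<n. if i < s then lt i else 1)" ..
  also have "\<dots> = (\<Prod>i<s. lt i)"
    using s by (intro prod.mono_neutral_cong_right) auto
  also have "det C0 = det (mat s s (\<lambda>(i, j). M i j))"
  proof -
    have "C0 = four_block_mat (mat s s (\<lambda>(i, j). M i j)) (0\<^sub>m s (n - s))
      (mat (n - s) s (\<lambda>(i, j). C0 $$ (i + s, j))) (1\<^sub>m (n - s))"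
    proof (rule eq_matI)
      fix i j assume "i < dim_row (four_block_mat (mat s s (\<lambda>(i, j). M i j)) (0\<^sub>m s (n - s))
          (mat (n - s) s (\<lambda>(i, j). C0 $$ (i + s, j))) (1\<^sub>m (n - s)))"
        "j < dim_col (four_block_mat (mat s s (\<lambda>(i, j). M i j)) (0\<^sub>m s (n - s))
          (mat (n - s) s (\<lambda>(i, j). C0 $$ (i + s, j))) (1\<^sub>m (n - s)))"
      then have ij: "i < n" "j < n" using s by auto
      have e1: "(s - i) + (s - 1 - j) + (i + j) - (2 * s - 1) = 0" if "i < s" "j < s" using that by auto
      have e2: "(s - i) + (s - 1 - j) + (i + j) - (2 * s - 1) > 0" if "j \<ge> s" using that s by auto
      show "C0 $$ (i, j) = four_block_mat (mat s s (\<lambda>(i, j). M i j)) (0\<^sub>m s (n - s))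
          (mat (n - s) s (\<lambda>(i, j). C0 $$ (i + s, j))) (1\<^sub>m (n - s)) $$ (i, j)"
        using ij s e1 e2 by (cases "i < s"; cases "j < s") (auto simp: C0_def power_0_left)
    qed (use s in \<open>auto simp: C0_def\<close>)
    then have "det C0 = det (mat s s (\<lambda>(i, j). M i j)) * det (1\<^sub>m (n - s))"
      by (metis det_four_block_mat_upper_right_zero mat_carrier one_carrier_mat)
    then show ?thesis by simp
  qed
  finally show ?thesis ..
qed

text \<open>A vector with \<open>s\<close> leading zeros sees only entries with
  \<open>i, j >= s\<close>, which are \<open>O(e ^ (2 * s))\<close>. Courant-Fischer bounds the
  eigenvalue from above; nonnegativity closes the other side.\<close>

lemma graded_eigenvalue_bigo:
  fixes B :: "real \<Rightarrow> real mat" and lam :: "nat \<Rightarrow> real \<Rightarrow> real"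
  assumes B: "\<And>e. B e \<in> carrier_mat n n"
    and M: "\<And>i j. i < n \<Longrightarrow> j < n \<Longrightarrow> ((\<lambda>e. B e $$ (i, j) / e ^ (i + j)) \<longlongrightarrow> M i j) (at_right 0)"
    and diag: "\<forall>\<^sub>F e in at_right 0. \<exists>U. ortho_mat n U \<and> transpose_mat U * B e * U = mat_diag n (\<lambda>i. lam i e)"
    and sorted: "\<forall>\<^sub>F e in at_right 0. \<forall>i j. i \<le> j \<and> j < n \<longrightarrow> lam j e \<le> lam i e"
    and nonneg: "\<forall>\<^sub>F e in at_right 0. \<forall>i<n. 0 \<le> lam i e"
    and s: "s < n"
  shows "lam s \<in> O[at_right 0](\<lambda>e. e ^ (2 * s))"
proof (rule bigoI)
  have "\<forall>\<^sub>F e in at_right 0. dist (B e $$ (i, j) / e ^ (i + j)) (M i j) < 1" if "i < n" "j < n" for i j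
    using M[OF that] by (rule tendstoD) simp
  then have "\<forall>\<^sub>F e in at_right 0. \<forall>i\<in>{..<n}. \<forall>j\<in>{..<n}. dist (B e $$ (i, j) / e ^ (i + j)) (M i j) < 1"
    by (intro eventually_ball_finite ballI) auto
  moreover have "\<forall>\<^sub>F e in at_right (0::real). e < 1"
    by (rule order_tendstoD[OF tendsto_ident_at]) simp
  ultimately show "\<forall>\<^sub>F e in at_right 0. norm (lam s e) \<le> (\<Sum>i<n. \<Sum>j<n. \<bar>M i j\<bar> + 1) * norm (e ^ (2 * s))"
    using eventually_at_right_less[of 0] diag sorted nonneg
  proof eventually_elim
    case (elim e)
    have Bij: "\<bar>B e $$ (i, j)\<bar> \<le> (\<bar>M i j\<bar> + 1) * e ^ (i + j)" if "i < n" "j < n" for i j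
    proof -
      have "\<bar>B e $$ (i, j) / e ^ (i + j)\<bar> \<le> \<bar>M i j\<bar> + 1"
        using elim(1)[rule_format, of i j] that unfolding dist_real_def by simp
      then show ?thesis using elim(3) by (simp add: abs_divide field_simps)
    qed
    obtain U where U: "ortho_mat n U" "transpose_mat U * B e * U = mat_diag n (\<lambda>i. lam i e)" using elim(4) by blast
    have "lam s e \<le> lam i e" if "i \<le> s" for i using elim(5) that s by blast
    from courant_fischer_upper[OF U(1) B U(2) s this] obtain v where v: "v \<in> carrier_vec n" "v \<bullet> v = 1" "\<And>i. i < s \<Longrightarrow> v $ i = 0"
      "lam s e \<le> v \<bullet> (B e *\<^sub>v v)"
      by blast
    have v1: "\<bar>v $ i\<bar> \<le> 1" if "i < n" for i
    proof -
      have "(v $ i)\<^sup>2 \<le> (\<Sum>i = 0..<n. (v $ i)\<^sup>2)" using that by (intro member_le_sum) auto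
      also have "\<dots> = 1" using v(1,2) by (simp add: scalar_prod_def power2_eq_square)
      finally show ?thesis by (simp add: abs_square_le_1)
    qed
    have "v \<bullet> (B e *\<^sub>v v) = (\<Sum>i<n. \<Sum>j<n. v $ i * (B e $$ (i, j) * v $ j))"
      using v(1) carrier_matD[OF B[of e]] by (auto simp: scalar_prod_def sum_distrib_left lessThan_atLeast0)
    also have "\<dots> \<le> (\<Sum>i<n. \<Sum>j<n. (\<bar>M i j\<bar> + 1) * e ^ (2 * s))"
    proof (intro sum_mono)
      fix i j assume ij: "i \<in> {..<n}" "j \<in> {..<n}"
      show "v $ i * (B e $$ (i, j) * v $ j) \<le> (\<bar>M i j\<bar> + 1) * e ^ (2 * s)"
      proof (cases "i < s \<or> j < s")
        case True
        then show ?thesis using v(3) elim(3) by auto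
      next
        case False
        have "v $ i * (B e $$ (i, j) * v $ j) \<le> \<bar>v $ i * (B e $$ (i, j) * v $ j)\<bar>" by simp
        also have "\<dots> \<le> 1 * (\<bar>B e $$ (i, j)\<bar> * 1)"
          unfolding abs_mult using v1 ij by (intro mult_mono) auto
        also have "\<dots> \<le> (\<bar>M i j\<bar> + 1) * e ^ (i + j)" using Bij ij by simp
        also have "\<dots> \<le> (\<bar>M i j\<bar> + 1) * e ^ (2 * s)"
          using elim(2,3) False by (intro mult_left_mono power_decreasing) auto
        finally show ?thesis .
      qed
    qed
    also have "\<dots> = (\<Sum>i<n. \<Sum>j<n. \<bar>M i j\<bar> + 1) * e ^ (2 * s)" by (simp add: sum_distrib_right)
    finally show ?case using v(4) elim(3,6) s by simp
  qed
qed

section \<open>Kernel matrices\<close>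

lemma psd_eigenvalue_nonneg:
  assumes psd: "sym_psd_mat A" and A: "A \<in> carrier_mat n n" and U: "ortho_mat n U"
    and D: "transpose_mat U * A * U = mat_diag n d" and i: "i < n"
  shows "0 \<le> d i"
proof -
  note U = ortho_matD(1)[OF U]
  have "d i = (transpose_mat U * A * U) $$ (i, i)" unfolding D using i by (simp add: mat_diag_def)
  also have "\<dots> = (transpose_mat U * (A * U)) $$ (i, i)"
    using U A by (simp add: assoc_mult_mat[of _ n n _ n _ n])
  also have "\<dots> = col U i \<bullet> (A *\<^sub>v col U i)"
    using U A i by (simp add: mult_mat_vec_def)
  also have "\<dots> \<ge> 0"
    using psd A U i unfolding sym_psd_mat_def by auto
  finally show ?thesis .
qed

text \<open>Multiplying \<open>V\<close> by \<open>Q^T\<close> keeps the Gram matrix and makes the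
  factor upper triangular, with zero rows from index \<open>k + 1\<close> on. The Gram determinant
  of a rectangular matrix thus becomes the square of a triangular determinant; repeated nodes can
  only make diagonal entries vanish.\<close>

lemma vandermonde_gram_det:
  assumes Q: "ortho_mat n Q" and tri: "\<And>i j. i < n \<Longrightarrow> j < i \<Longrightarrow> (\<Sum>l<n. Q $$ (l, i) * x l ^ j) = 0"
    and k: "k < n"
  shows "det (transpose_mat (vandermonde n x k) * vandermonde n x k) =
    (\<Prod>i<k + 1. (\<Sum>l<n. Q $$ (l, i) * x l ^ i)\<^sup>2)"
proof -
  note Q' = ortho_matD[OF Q]
  define V where "V = vandermonde n x k"
  have V: "V \<in> carrier_mat n (k + 1)" by (simp add: V_def vandermonde_def)
  define T where "T = transpose_mat Q * V"
  have T: "T \<in> carrier_mat n (k + 1)" using Q'(1) V by (simp add: T_def)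
  have Tij: "T $$ (i, j) = (\<Sum>l<n. Q $$ (l, i) * x l ^ j)" if "i < n" "j < k + 1" for i j
    using that Q'(1) V by (simp add: T_def V_def vandermonde_def scalar_prod_def lessThan_atLeast0)
  have "transpose_mat T * T = transpose_mat V * Q * (transpose_mat Q * V)"
    unfolding T_def using Q'(1) V by (subst Matrix.transpose_mult[of _ n n]) auto
  also have "\<dots> = transpose_mat V * (Q * transpose_mat Q) * V"
    using Q'(1) V
    by (simp add: assoc_mult_mat[of _ "k + 1" n _ n _ n] assoc_mult_mat[of _ "k + 1" n _ n _ "k + 1"]
        assoc_mult_mat[of _ n n _ n _ "k + 1"])
  also have "\<dots> = transpose_mat V * V" using Q'(3) V by simp
  finally have VT: "transpose_mat V * V = transpose_mat T * T" ..
  define R where "R = mat (k + 1) (k + 1) (\<lambda>(i, j). T $$ (i, j))"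
  have R: "R \<in> carrier_mat (k + 1) (k + 1)" by (simp add: R_def)
  have "transpose_mat T * T = transpose_mat R * R"
  proof (rule eq_matI)
    fix i j assume "i < dim_row (transpose_mat R * R)" "j < dim_col (transpose_mat R * R)"
    then have ij: "i < k + 1" "j < k + 1" using R by auto
    have "(transpose_mat T * T) $$ (i, j) = (\<Sum>l<n. T $$ (l, i) * T $$ (l, j))"
      using T ij by (simp add: scalar_prod_def lessThan_atLeast0)
    also have "\<dots> = (\<Sum>l<k + 1. T $$ (l, i) * T $$ (l, j))"
    proof (intro sum.mono_neutral_right ballI)
      fix l assume "l \<in> {..<n} - {..<k + 1}"
      then have "T $$ (l, i) = 0" using ij tri[of l i] by (subst Tij) auto
      then show "T $$ (l, i) * T $$ (l, j) = 0" by simp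
    qed (use k in auto)
    also have "\<dots> = (transpose_mat R * R) $$ (i, j)"
      using ij by (simp add: R_def scalar_prod_def lessThan_atLeast0)
    finally show "(transpose_mat T * T) $$ (i, j) = (transpose_mat R * R) $$ (i, j)" .
  qed (use T R in auto)
  then have "det (transpose_mat V * V) = det R * det R"
    unfolding VT using R by (simp add: det_mult[of _ "k + 1"] det_transpose)
  moreover have "det R = (\<Prod>i<k + 1. \<Sum>l<n. Q $$ (l, i) * x l ^ i)"
  proof -
    have "upper_triangular R"
      using k by (auto simp: R_def upper_triangular_def Tij tri)
    then have "det R = (\<Prod>i<k + 1. R $$ (i, i))" using R by (rule det_upper_triangular_prod)
    also have "\<dots> = (\<Prod>i<k + 1. \<Sum>l<n. Q $$ (l, i) * x l ^ i)"
      using k by (intro prod.cong) (auto simp: R_def Tij)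
    finally show ?thesis .
  qed
  ultimately show ?thesis unfolding V_def by (simp add: power2_eq_square prod.distrib)
qed

lemma det_diag_conj_wronskian:
  "det (mat (k + 1) (k + 1) (\<lambda>(i, j). R i * R j * (pderiv2 K i j 0 0 / (fact i * fact j)))) =
    (\<Prod>i<k + 1. (R i)\<^sup>2) * det (wronskian K k)"
proof -
  have W: "wronskian K k \<in> carrier_mat (k + 1) (k + 1)" by (simp add: wronskian_def)
  have "mat (k + 1) (k + 1) (\<lambda>(i, j). R i * R j * (pderiv2 K i j 0 0 / (fact i * fact j))) =
    mat_diag (k + 1) R * wronskian K k * mat_diag (k + 1) R"
    unfolding mat_diag_mult_left[OF W]
    by (subst mat_diag_mult_right[of _ "k + 1"]) (auto simp: wronskian_def intro!: eq_matI)
  also have "det \<dots> = det (mat_diag (k + 1) R) * det (wronskian K k) * det (mat_diag (k + 1) R)"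
    unfolding det_mult[OF mult_carrier_mat[OF mat_diag_dim W] mat_diag_dim] det_mult[OF mat_diag_dim W] ..
  finally show ?thesis by (simp add: det_mat_diag power2_eq_square prod.distrib mult_ac)
qed

lemma Kmat_carrier: "Kmat K n x e \<in> carrier_mat n n"
  by (simp add: Kmat_def)

lemma ortho_conj_Kmat_index:
  assumes "ortho_mat n Q" "i < n" "j < n"
  shows "(transpose_mat Q * Kmat K n x e * Q) $$ (i, j) =
    (\<Sum>p<n. \<Sum>q<n. Q $$ (p, i) * Q $$ (q, j) * K (e * x p) (e * x q))"
proof -
  note Q = ortho_matD(1)[OF assms(1)]
  have "transpose_mat Q * Kmat K n x e * Q = transpose_mat Q * (Kmat K n x e * Q)"
    using Q Kmat_carrier[of K n x e] by (intro assoc_mult_mat[of _ n n _ n _ n]) auto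
  then show ?thesis
    using Q assms(2,3) by (simp add: Kmat_def scalar_prod_def sum_distrib_left lessThan_atLeast0 mult_ac)
qed

lemma real_analytic_on_center_expansion:
  assumes "real_analytic_on f {-r<..<r}" "r > 0"
  obtains c \<rho> where "\<rho> > 0" "\<And>e. \<bar>e\<bar> < \<rho> \<Longrightarrow> (\<lambda>k. c k * e ^ k) sums f e"
proof -
  have "0 \<in> {-r<..<r}" using assms(2) by simp
  with assms(1) obtain c \<rho> where "\<rho> > 0" "\<forall>e. \<bar>e - 0\<bar> < \<rho> \<longrightarrow> (\<lambda>k. c k * (e - 0) ^ k) sums f e"
    unfolding real_analytic_on_def by blast
  then show ?thesis by (intro that[of \<rho> c]) auto
qed

text \<open>Symmetry for positive \<open>e\<close> extends to negative \<open>e\<close> through the power series coefficients.\<close>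

lemma real_analytic_eq_near_0:
  assumes f: "real_analytic_on f {-r<..<r}" and g: "real_analytic_on g {-r<..<r}" and r: "r > 0"
    and eq: "\<And>e. 0 \<le> e \<Longrightarrow> e \<le> d \<Longrightarrow> f e = g e" and d: "d > 0"
  shows "\<forall>\<^sub>F e in at 0. f e = g e"
proof -
  obtain a s where a: "s > 0" "\<And>e. \<bar>e\<bar> < s \<Longrightarrow> (\<lambda>k. a k * e ^ k) sums f e"
    using real_analytic_on_center_expansion[OF f r] by blast
  obtain b t where b: "t > 0" "\<And>e. \<bar>e\<bar> < t \<Longrightarrow> (\<lambda>k. b k * e ^ k) sums g e"
    using real_analytic_on_center_expansion[OF g r] by blast
  define \<rho> where "\<rho> = min s t"
  have \<rho>: "\<rho> > 0" using a b by (simp add: \<rho>_def)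
  have diff: "(\<lambda>k. (a k - b k) * e ^ k) sums (f e - g e)" if "\<bar>e\<bar> < \<rho>" for e
    using sums_diff[OF a(2) b(2), of e e] that by (simp add: \<rho>_def ring_distribs)
  have coeff: "a k - b k = 0" for k
  proof (rule ccontr)
    assume k: "a k - b k \<noteq> 0"
    \<comment> \<open>The constant coefficient is \<open>f 0 - g 0 = 0\<close>. Isolation of zeros,
      applied next, wants a nonzero coefficient of positive index and a zero at the centre; it then
      contradicts \<open>eq\<close> at a small positive argument.\<close>
    have "(a 0 - b 0) * 0 ^ 0 = f 0 - g 0"
      using diff[of 0] \<rho> powser_sums_zero[of "\<lambda>k. a k - b k"] by (auto dest: sums_unique2)
    then have "k > 0" using k eq[of 0] d by (cases k) auto
    then obtain u where u: "u > 0" "\<And>z. z \<in> cball 0 u - {0} \<Longrightarrow> f z - g z \<noteq> 0"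
      using powser_0_nonzero[of \<rho> 0 "\<lambda>k. a k - b k" "\<lambda>e. f e - g e" k] \<rho> diff k eq[of 0] d by auto
    then show False using u(2)[of "min u d"] eq[of "min u d"] d by auto
  qed
  have "f e = g e" if "\<bar>e\<bar> < \<rho>" for e
    using diff[OF that] coeff sums_unique2[OF _ sums_zero] by force
  then show ?thesis unfolding eventually_at using \<rho> by (intro exI[of _ \<rho>]) (auto simp: dist_real_def)
qed

theorem theorem4p2:
  fixes a eps0 :: real and n :: nat and K :: "real \<Rightarrow> real \<Rightarrow> real"
    and x :: "nat \<Rightarrow> real" and lam :: "nat \<Rightarrow> real \<Rightarrow> real"
  assumes "a > 0"
    and "C_ll n {-a<..<a} K"
    and "eps0 > 0"
    and "\<forall>e\<in>{0..eps0}. sym_psd_mat (Kmat K n x e)"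
    and "\<exists>r>0. \<forall>i<n. \<forall>j<n. real_analytic_on (\<lambda>e. K (e * x i) (e * x j)) {-r<..<r}"
    and "\<exists>\<delta>>0. \<forall>e\<in>{0<..<\<delta>}.
           (\<forall>s\<in>{1..<n}. lam s e \<ge> lam (Suc s) e) \<and>
           char_poly (Kmat K n x e) = (\<Prod>s\<in>{1..n}. [:- lam s e, 1:])"
  shows "\<exists>lt :: nat \<Rightarrow> real. \<forall>s\<in>{1..n}.
           (\<lambda>e. lam s e - e ^ (2 * (s - 1)) * lt s) \<in> bigo (at_right (0::real)) (\<lambda>e. e ^ (2 * (s - 1)) * e) \<and>
           (\<Prod>i\<in>{1..s}. lt i) =
             det (transpose_mat (vandermonde n x (s - 1)) * vandermonde n x (s - 1))
             * det (wronskian K (s - 1))"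
proof -
  define A where "A = Kmat K n x"
  \<comment> \<open>Indices now start at 0, so that \<open>\<mu> i\<close> has order
    \<open>e ^ (2 * i)\<close>.\<close>
  define \<mu> where "\<mu> = (\<lambda>i. lam (Suc i))"
  have A: "A e \<in> carrier_mat n n" for e by (simp add: A_def Kmat_carrier)
  obtain r where r: "r > 0" "\<And>i j. i < n \<Longrightarrow> j < n \<Longrightarrow> real_analytic_on (\<lambda>e. K (e * x i) (e * x j)) {-r<..<r}"
    using assms(5) by blast
  have exp: "has_expansions (\<lambda>e. A e $$ (i, j))" if ij: "i < n" "j < n" for i j
  proof -
    obtain c \<rho> where "\<rho> > 0" "\<And>e. \<bar>e\<bar> < \<rho> \<Longrightarrow> (\<lambda>k. c k * e ^ k) sums K (e * x i) (e * x j)"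
      using real_analytic_on_center_expansion[OF r(2)[OF ij] r(1)] by blast
    then have "has_expansions (\<lambda>e. K (e * x i) (e * x j))" by (intro real_analytic_has_expansions)
    with ij show ?thesis by (simp add: A_def Kmat_def)
  qed
  have Asym: "transpose_mat (A e) = A e" if "0 \<le> e" "e \<le> eps0" for e
    using assms(4) that by (auto simp: sym_psd_mat_def A_def)
  have "\<forall>\<^sub>F e in at 0. \<forall>i\<in>{..<n}. \<forall>j\<in>{..<n}. K (e * x j) (e * x i) = K (e * x i) (e * x j)"
  proof (intro eventually_ball_finite ballI)
    fix i j assume ij: "i \<in> {..<n}" "j \<in> {..<n}"
    show "\<forall>\<^sub>F e in at 0. K (e * x j) (e * x i) = K (e * x i) (e * x j)"
    proof (rule real_analytic_eq_near_0[OF r(2) r(2) r(1) _ assms(3)])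
      fix e assume "0 \<le> e" "e \<le> eps0"
      from arg_cong[OF Asym[OF this], of "\<lambda>M. M $$ (i, j)"] ij
      show "K (e * x j) (e * x i) = K (e * x i) (e * x j)" by (simp add: A_def Kmat_def)
    qed (use ij in auto)
  qed auto
  then have sym: "\<forall>\<^sub>F e in at 0. transpose_mat (A e) = A e"
    by eventually_elim (auto simp: A_def Kmat_def intro!: eq_matI)
  obtain \<delta> where \<delta>: "\<delta> > 0" "\<And>e. 0 < e \<Longrightarrow> e < \<delta> \<Longrightarrow> (\<forall>s\<in>{1..<n}. lam s e \<ge> lam (Suc s) e) \<and>
      char_poly (Kmat K n x e) = (\<Prod>s\<in>{1..n}. [:- lam s e, 1:])"
    using assms(6) by auto
  have small: "\<forall>\<^sub>F e in at_right 0. 0 < e \<and> e < \<delta> \<and> e \<le> eps0"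
  proof -
    have "\<forall>\<^sub>F e in at_right 0. e \<in> {0<..<min \<delta> eps0}"
      using \<delta>(1) assms(3) by (intro eventually_at_right_real) auto
    then show ?thesis by eventually_elim auto
  qed
  have sorted: "\<mu> j e \<le> \<mu> i e" if "0 < e" "e < \<delta>" "i \<le> j" "j < n" for e i j
    using that(3,4)
  proof (induction j rule: dec_induct)
    case (step j)
    have "lam (Suc (Suc j)) e \<le> lam (Suc j) e" using \<delta>(2)[OF that(1,2)] step by auto
    with step show ?case by (auto simp: \<mu>_def)
  qed auto
  have char: "char_poly (A e) = (\<Prod>b\<leftarrow>map (\<lambda>i. \<mu> i e) [0..<n]. [:- b, 1:])" if "0 < e" "e < \<delta>" for e
  proof -
    have "char_poly (A e) = (\<Prod>s\<in>{1..n}. [:- lam s e, 1:])" using \<delta>(2)[OF that] by (simp add: A_def)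
    also have "\<dots> = (\<Prod>i<n. [:- \<mu> i e, 1:])"
      by (rule prod.reindex_bij_witness[of _ Suc "\<lambda>s. s - 1"]) (auto simp: \<mu>_def)
    also have "\<dots> = (\<Prod>b\<leftarrow>map (\<lambda>i. \<mu> i e) [0..<n]. [:- b, 1:])"
      by (simp add: prod.list_conv_set_nth lessThan_atLeast0)
    finally show ?thesis .
  qed
  have "\<forall>\<^sub>F e in at_right 0. (\<forall>i j. i \<le> j \<and> j < n \<longrightarrow> \<mu> j e \<le> \<mu> i e) \<and>
      char_poly (A e) = (\<Prod>b\<leftarrow>map (\<lambda>i. \<mu> i e) [0..<n]. [:- b, 1:])"
    using small by eventually_elim (use sorted char in blast)
  \<comment> \<open>Order \<open>2 * n\<close> exceeds every error order \<open>2 * i + 1\<close>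
    with \<open>i < n\<close>.\<close>
  from symmetric_family_eigenvalue_expansions[OF A exp sym this, where m = "2 * n"]
  obtain p where p: "\<And>i. i < n \<Longrightarrow> (\<lambda>e. \<mu> i e - poly (p i) e) \<in> O[at_right 0](\<lambda>e. e ^ (2 * n))" by blast
  obtain Q where Q: "ortho_mat n Q" "\<And>i j. i < n \<Longrightarrow> j < i \<Longrightarrow> vec n (\<lambda>l. x l ^ j) \<bullet> col Q i = 0"
    using ortho_mat_triangular[of n "\<lambda>j. vec n (\<lambda>l. x l ^ j)"] by auto
  note Q' = ortho_matD[OF Q(1)]
  have tri: "(\<Sum>l<n. Q $$ (l, i) * x l ^ j) = 0" if "i < n" "j < i" for i j
    using Q(2)[OF that] Q'(1) that by (simp add: scalar_prod_def lessThan_atLeast0 mult_ac)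
  \<comment> \<open>\<open>R i\<close> is the \<open>i\<close>-th diagonal entry of the triangular
    matrix \<open>Q^T V\<close>; \<open>M\<close> is the entrywise limit of \<open>B\<close> after
    removal of the powers of \<open>e\<close>.\<close>
  define R where "R = (\<lambda>i. \<Sum>l<n. Q $$ (l, i) * x l ^ i)"
  define M where "M = (\<lambda>i j. R i * R j * (pderiv2 K i j 0 0 / (fact i * fact j)))"
  define B where "B = (\<lambda>e. transpose_mat Q * A e * Q)"
  have B: "B e \<in> carrier_mat n n" for e
    unfolding B_def using Q'(1) A[of e] by (intro mult_carrier_mat[of _ n n]) auto
  have M: "((\<lambda>e. B e $$ (i, j) / e ^ (i + j)) \<longlongrightarrow> M i j) (at_right 0)" if "i < n" "j < n" for i j
    unfolding B_def A_def ortho_conj_Kmat_index[OF Q(1) that] M_def R_def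
    using that tri by (intro annihilating_form_limit[OF assms(2,1)]) auto
  \<comment> \<open>Stated for a general matrix because it serves twice: for \<open>A\<close>, whose
    positivity makes the eigenvalues nonnegative, and for \<open>B\<close>, whose entries carry the
    grading.\<close>
  have diag: "\<exists>U. ortho_mat n U \<and> transpose_mat U * X * U = mat_diag n (\<lambda>i. \<mu> i e)"
    if X: "X \<in> carrier_mat n n" "transpose_mat X = X"
      "char_poly X = (\<Prod>b\<leftarrow>map (\<lambda>i. \<mu> i e) [0..<n]. [:- b, 1:])" for X e
  proof -
    have "mat_diag n ((!) (map (\<lambda>i. \<mu> i e) [0..<n])) = mat_diag n (\<lambda>i. \<mu> i e)"
      by (auto simp: mat_diag_def intro!: eq_matI)
    with spectral_decomposition[OF X] show ?thesis by simp
  qed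
  have diagA: "\<exists>U. ortho_mat n U \<and> transpose_mat U * A e * U = mat_diag n (\<lambda>i. \<mu> i e)"
    if e: "0 < e" "e < \<delta>" "e \<le> eps0" for e
    using e by (intro diag A Asym char) auto
  have diagB: "\<exists>U. ortho_mat n U \<and> transpose_mat U * B e * U = mat_diag n (\<lambda>i. \<mu> i e)"
    if e: "0 < e" "e < \<delta>" "e \<le> eps0" for e
  proof (rule diag[OF B])
    show "transpose_mat (B e) = B e"
      unfolding B_def using e by (intro symmetric_ortho_conj[OF Q'(1) A] Asym) auto
    show "char_poly (B e) = (\<Prod>b\<leftarrow>map (\<lambda>i. \<mu> i e) [0..<n]. [:- b, 1:])"
      unfolding B_def char_poly_similar[OF similar_ortho_conj[OF Q(1) A], symmetric] using e by (intro char) auto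
  qed
  have \<mu>O: "\<mu> i \<in> O[at_right 0](\<lambda>e. e ^ (2 * i))" if "i < n" for i
  proof (rule graded_eigenvalue_bigo[OF B M _ _ _ that])
    show "\<forall>\<^sub>F e in at_right 0. \<exists>U. ortho_mat n U \<and> transpose_mat U * B e * U = mat_diag n (\<lambda>i. \<mu> i e)"
      using small by eventually_elim (use diagB in blast)
    show "\<forall>\<^sub>F e in at_right 0. \<forall>i j. i \<le> j \<and> j < n \<longrightarrow> \<mu> j e \<le> \<mu> i e"
      using small by eventually_elim (use sorted in blast)
    show "\<forall>\<^sub>F e in at_right 0. \<forall>i<n. 0 \<le> \<mu> i e"
      using small
    proof eventually_elim
      case (elim e)
      then obtain U where U: "ortho_mat n U" "transpose_mat U * A e * U = mat_diag n (\<lambda>i. \<mu> i e)"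
        using diagA by blast
      have "sym_psd_mat (A e)" using assms(4) elim by (auto simp: A_def)
      from psd_eigenvalue_nonneg[OF this A U] show ?case by blast
    qed
  qed
  \<comment> \<open>The bound on \<open>\<mu> i\<close> passes to the approximating polynomial and
    makes it divisible by \<open>e ^ (2 * i)\<close>. The constant coefficient of the quotient is
    the wanted number, and its other terms go into the error.\<close>
  have "\<exists>l. (\<lambda>e. \<mu> i e - e ^ (2 * i) * l) \<in> O[at_right 0](\<lambda>e. e ^ (2 * i) * e)" if i: "i < n" for i
  proof -
    have le: "(\<lambda>e::real. e ^ k) \<in> O[at_right 0](\<lambda>e. e ^ l)" if "l \<le> k" for k l
      using power_bigo_power[OF that] by (rule landau_o.big.filter_mono[rotated]) (simp add: at_le)
    have "(\<lambda>e. \<mu> i e - (\<mu> i e - poly (p i) e)) \<in> O[at_right 0](\<lambda>e. e ^ (2 * i))"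
      using i by (intro sum_in_bigo(2)[OF \<mu>O landau_o.big_trans[OF p le]]) auto
    then have "poly (p i) \<in> O[at_right 0](\<lambda>e. e ^ (2 * i))" by simp
    then obtain q where q: "p i = monom 1 (2 * i) * q" by (rule poly_bigo_powerE)
    obtain c q' where q': "q = pCons c q'" by (cases q)
    have "poly q' \<in> O[at_right 0](\<lambda>_. 1)"
      using poly_bigo_1 by (rule landau_o.big.filter_mono[rotated]) (simp add: at_le)
    from landau_o.big.mult[OF landau_o.big_refl this, of "\<lambda>e. e ^ (2 * i) * e"]
    have "(\<lambda>e. e ^ (2 * i) * e * poly q' e) \<in> O[at_right 0](\<lambda>e. e ^ (2 * i) * e)" by simp
    moreover have "(\<lambda>e. \<mu> i e - poly (p i) e) \<in> O[at_right 0](\<lambda>e. e ^ (2 * i) * e)"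
      using landau_o.big_trans[OF p[OF i] le[of "Suc (2 * i)" "2 * n"]] i by (simp add: mult.commute)
    ultimately have "(\<lambda>e. \<mu> i e - poly (p i) e + e ^ (2 * i) * e * poly q' e) \<in> O[at_right 0](\<lambda>e. e ^ (2 * i) * e)"
      by (intro sum_in_bigo(1))
    moreover have "\<mu> i e - poly (p i) e + e ^ (2 * i) * e * poly q' e = \<mu> i e - e ^ (2 * i) * c" for e
      by (simp add: q q' poly_monom algebra_simps)
    ultimately show ?thesis by auto
  qed
  then have "\<forall>i\<in>{..<n}. \<exists>l. (\<lambda>e. \<mu> i e - e ^ (2 * i) * l) \<in> O[at_right 0](\<lambda>e. e ^ (2 * i) * e)" by simp
  from bchoice[OF this] obtain l where
    l: "\<And>i. i < n \<Longrightarrow> (\<lambda>e. \<mu> i e - e ^ (2 * i) * l i) \<in> O[at_right 0](\<lambda>e. e ^ (2 * i) * e)"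
    by auto
  have lim: "((\<lambda>e. \<mu> i e / e ^ (2 * i)) \<longlongrightarrow> l i) (at_right 0)" if i: "i < n" for i
  proof -
    obtain C where "\<forall>\<^sub>F e in at_right 0. norm (\<mu> i e - e ^ (2 * i) * l i) \<le> C * norm (e ^ (2 * i) * e)"
      using l[OF i] by (rule landau_o.bigE)
    then have "\<forall>\<^sub>F e in at_right 0. norm (\<mu> i e / e ^ (2 * i) - l i) \<le> norm e * C"
      using eventually_at_right_less[of 0]
    proof eventually_elim
      case (elim e)
      have "\<mu> i e / e ^ (2 * i) - l i = (\<mu> i e - e ^ (2 * i) * l i) / e ^ (2 * i)"
        using elim(2) by (simp add: field_simps)
      then show ?case using elim by (simp add: field_simps abs_mult)
    qed
    then have "((\<lambda>e. \<mu> i e / e ^ (2 * i) - l i) \<longlongrightarrow> 0) (at_right 0)"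
      by (rule tendsto_0_le[OF tendsto_ident_at])
    then show ?thesis by (simp add: LIM_zero_iff)
  qed
  have det: "\<forall>\<^sub>F e in at_right 0. \<forall>t. det (t \<cdot>\<^sub>m 1\<^sub>m n + B e) = (\<Prod>i<n. t + \<mu> i e)"
    using small
  proof eventually_elim
    case (elim e)
    then obtain U where "ortho_mat n U" "transpose_mat U * B e * U = mat_diag n (\<lambda>i. \<mu> i e)"
      using diagB by blast
    then show ?case using det_shift_eigenvalues[OF _ B] by blast
  qed
  show ?thesis
  proof (intro exI[of _ "\<lambda>s. l (s - 1)"] ballI conjI)
    fix s assume s: "s \<in> {1..n}"
    then obtain k where k: "s = Suc k" "k < n" by (cases s) auto
    show "(\<lambda>e. lam s e - e ^ (2 * (s - 1)) * l (s - 1)) \<in> O[at_right 0](\<lambda>e. e ^ (2 * (s - 1)) * e)"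
      using l[OF k(2)] by (simp add: k(1) \<mu>_def)
    have "(\<Prod>i\<in>{1..s}. l (i - 1)) = (\<Prod>i<s. l i)"
      by (rule prod.reindex_bij_witness[of _ Suc "\<lambda>s. s - 1"]) auto
    also have "\<dots> = det (mat s s (\<lambda>(i, j). M i j))"
      using s by (intro graded_eigenvalue_product[OF B M det lim]) auto
    also have "\<dots> = (\<Prod>i<k + 1. (R i)\<^sup>2) * det (wronskian K k)"
      unfolding M_def k(1) Suc_eq_plus1 by (rule det_diag_conj_wronskian)
    also have "(\<Prod>i<k + 1. (R i)\<^sup>2) = det (transpose_mat (vandermonde n x k) * vandermonde n x k)"
      unfolding R_def by (rule vandermonde_gram_det[OF Q(1) tri k(2), symmetric])
    finally show "(\<Prod>i\<in>{1..s}. l (i - 1)) =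
        det (transpose_mat (vandermonde n x (s - 1)) * vandermonde n x (s - 1)) * det (wronskian K (s - 1))"
      by (simp add: k(1))
  qed
qed

end
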